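(* Let $X$ be a Banach space. Let $(a_n)_{n\ge1}$ be a decreasing sequence of real numbers with $a_1=1$ and $\lim_{n\to\infty}a_n=0$, let $I_n:=(a_{n+1},a_n)$, let $E_n\subseteq I_n$ for every $n$, and let $(x_n)_{n\ge 1}$ be a sequence in $X$. Let $g:[0,1]\to X$ be the function $$g(t)=\sum_{n=1}^{\infty}x_n 1_{E_n}(t),$$ and assume that $g$ is Pettis integrable and variationally Henstock integrable. Then the multifunction $G:[0,1]\to ck(X)$ determined by $g$, i.e. $G(t)=\mathrm{conv}\{0,g(t)\}$, is variationally Henstock integrable.
   Context: $[0,1]$ carries Lebesgue measure; $1_E$ is the indicator function of $E$; $|I|$ is the length of an interval $I$. $ck(X)$ is the family of all nonempty convex compact subsets of $X$, with the Hausdorff metric $d_H$ and Minkowski addition. $\mathcal{I}$ is the collection of all closed subintervals of $[0,1]$. A Perron partition in $[0,1]$ is a finite collection of pairs $\{(I_1,t_1),\dots,(I_p,t_p)\}$ where $I_1,\dots,I_p$ are nonoverlapping closed subintervals of $[0,1]$ (their union need not be $[0,1]$) and $t_i\in I_i$. A gauge is a function $\delta:[0,1]\to(0,\infty)$; a partition is $\delta$-fine if $I_i\subset(t_i-\delta(t_i),t_i+\delta(t_i))$ for all $i$. A multifunction $G:[0,1]\to ck(X)$ is variationally Henstock integrable if there exists an interval multimeasure $\Phi_G:\mathcal{I}\to ck(X)$ (i.e. $\Phi_G(I\cup J)=\Phi_G(I)+\Phi_G(J)$ whenever $I,J\in\mathcal I$ are nonoverlapping and $I\cup J\in\mathcal{I}$)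 such that for every $\varepsilon>0$ there is a gauge $\delta$ on $[0,1]$ with $\sum_{j=1}^p d_H(\Phi_G(I_j),G(t_j)|I_j|)<\varepsilon$ for each $\delta$-fine Perron partition $\{(I_j,t_j)\}_{j=1}^p$ in $[0,1]$. Variational Henstock integrability of a function $g:[0,1]\to X$ is defined in the same way with an additive interval function $\Phi_g:\mathcal I\to X$ and $d_H$ replaced by the norm distance. A function $g:[0,1]\to X$ is Pettis integrable if $\langle x^*,g\rangle$ is Lebesgue integrable for every $x^*\in X^*$ and for every Lebesgue measurable $E\subseteq[0,1]$ there is $\nu_g(E)\in X$ with $\langle x^*,\nu_g(E)\rangle=\int_E\langle x^*,g\rangle\,d\lambda$ for all $x^*\in X^*$. *)

theory Defs
  imports "HOL-Analysis.Analysis" "HOL-Library.Set_Algebras"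
begin

definition ck :: "'a::real_normed_vector set set" where
  "ck = {C. C \<noteq> {} \<and> convex C \<and> compact C}"

text \<open>The suprema are taken over bounded sets of reals, and so have their usual meaning,
  whenever \<open>A\<close> and \<open>B\<close> are nonempty and bounded, in particular on \<^const>\<open>ck\<close>.\<close>

definition hausdorff_dist :: "'a::metric_space set \<Rightarrow> 'a set \<Rightarrow> real" where
  "hausdorff_dist A B = max (SUP x\<in>A. infdist x B) (SUP y\<in>B. infdist y A)"

text \<open>One-point intervals are allowed. They carry no information: additivity applied to
  \<open>{c} \<union> {c} = {c}\<close> forces an additive interval function to vanish on them
  (to be \<open>{0}\<close> in the case of multimeasures).\<close>

definition subintervals :: "real set set" where
  "subintervals = {{c..d} | c d. 0 \<le> c \<and> c \<le> d \<and> d \<le> 1}"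

definition nonoverlapping :: "real set \<Rightarrow> real set \<Rightarrow> bool" where
  "nonoverlapping I J \<longleftrightarrow> interior I \<inter> interior J = {}"

text \<open>On the values of an interval multimeasure, \<open>+\<close> is Minkowski addition
  (from \<^theory>\<open>HOL-Library.Set_Algebras\<close>).\<close>

definition additive_interval_function :: "(real set \<Rightarrow> 'b::plus) \<Rightarrow> bool" where
  "additive_interval_function \<Phi> \<longleftrightarrow>
    (\<forall>I\<in>subintervals. \<forall>J\<in>subintervals.
       nonoverlapping I J \<and> I \<union> J \<in> subintervals \<longrightarrow> \<Phi> (I \<union> J) = \<Phi> I + \<Phi> J)"

definition interval_multimeasure :: "(real set \<Rightarrow> 'a::real_normed_vector set) \<Rightarrow> bool" where
  "interval_multimeasure \<Phi> \<longleftrightarrow>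
    (\<forall>I\<in>subintervals. \<Phi> I \<in> ck) \<and> additive_interval_function \<Phi>"

text \<open>Perron partitions in \<open>[0,1]\<close> are the tagged partial divisions of \<open>{0..1}\<close>; a pair
  consists of the tag followed by the interval.\<close>

definition fine_perron_partition :: "(real \<Rightarrow> real) \<Rightarrow> (real \<times> real set) set \<Rightarrow> bool" where
  "fine_perron_partition \<delta> p \<longleftrightarrow>
    p tagged_partial_division_of {0..1} \<and> (\<lambda>t. {t - \<delta> t <..< t + \<delta> t}) fine p"

definition vH_integrable_multi :: "(real \<Rightarrow> 'a::real_normed_vector set) \<Rightarrow> bool" where
  "vH_integrable_multi G \<longleftrightarrow>
    (\<forall>t\<in>{0..1}. G t \<in> ck) \<and>
    (\<exists>\<Phi>. interval_multimeasure \<Phi> \<and>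
      (\<forall>\<epsilon>>0. \<exists>\<delta>. (\<forall>t\<in>{0..1}. \<delta> t > 0) \<and>
        (\<forall>p. fine_perron_partition \<delta> p \<longrightarrow>
          (\<Sum>(t, I)\<in>p. hausdorff_dist (\<Phi> I) ((\<lambda>y. measure lborel I *\<^sub>R y) ` G t)) < \<epsilon>)))"

definition vH_integrable :: "(real \<Rightarrow> 'a::real_normed_vector) \<Rightarrow> bool" where
  "vH_integrable g \<longleftrightarrow>
    (\<exists>\<Phi>. additive_interval_function \<Phi> \<and>
      (\<forall>\<epsilon>>0. \<exists>\<delta>. (\<forall>t\<in>{0..1}. \<delta> t > 0) \<and>
        (\<forall>p. fine_perron_partition \<delta> p \<longrightarrow>
          (\<Sum>(t, I)\<in>p. norm (\<Phi> I - measure lborel I *\<^sub>R g t)) < \<epsilon>)))"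

definition pettis_integrable :: "(real \<Rightarrow> 'a::real_normed_vector) \<Rightarrow> bool" where
  "pettis_integrable g \<longleftrightarrow>
    (\<forall>\<phi>::'a \<Rightarrow> real. bounded_linear \<phi> \<longrightarrow> set_integrable lebesgue {0..1} (\<lambda>t. \<phi> (g t))) \<and>
    (\<forall>E\<in>sets lebesgue. E \<subseteq> {0..1} \<longrightarrow>
      (\<exists>\<nu>. \<forall>\<phi>::'a \<Rightarrow> real. bounded_linear \<phi> \<longrightarrow>
         \<phi> \<nu> = set_lebesgue_integral lebesgue E (\<lambda>t. \<phi> (g t))))"

end

theory Submission
  imports Defs
begin

text \<open>The primitive of \<open>G\<close> maps an interval \<open>I\<close> to the zonoid of all sums
  \<open>\<Sum>n. s n *\<^sub>R |E n \<inter> I| *\<^sub>R x n\<close> with coefficients \<open>s n \<in> [0,1]\<close>. Pettis integrability says that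
  the series of the \<open>|E n| *\<^sub>R x n\<close> is weakly subseries convergent, so by the Orlicz--Pettis theorem
  it converges unconditionally; hence these sets are convex and compact, and they depend
  additively on \<open>I\<close>. The Hausdorff distance of such a set to the scaled segment \<open>|I| G(t)\<close> is
  estimated term by term, since both sets are parametrized by the same sequences \<open>s\<close>.\<close>

section \<open>The Hahn--Banach theorem\<close>

text \<open>On \<open>E n\<close> the multifunction is the segment from 0 to \<open>x n\<close>, so
  integrating a selection over an interval I picks up on \<open>E n\<close> a multiple of
  \<open>x n\<close> with coefficient between 0 and the measure of \<open>E n \<inter> I\<close>;
  this is the origin of the zonoid. The obstacle is the point 0, the only one at which infinitely
  many of the sets can accumulate. The norms of the vectors |E n| \<open>x n\<close> may have a
  divergent sum, so near 0 smallness must come from unconditional convergence, uniformly in the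
  coefficients s and in I. Weak subseries convergence is obtained by integrating g over unions of
  the \<open>E n\<close>. Turning it into smallness in norm is a separation argument, for which
  functionals are needed that vanish on a given subspace and attain the distance of a given point
  from it. The sets \<open>E n\<close> are not given as measurable. Those with a nonzero coefficient
  are recovered from the measurable scalar functions f(g(t)); the others do not affect g.\<close>

definition sublinear :: "('a::real_vector \<Rightarrow> real) \<Rightarrow> bool" where
  "sublinear p \<longleftrightarrow> (\<forall>x y. p (x + y) \<le> p x + p y) \<and> (\<forall>t x. 0 \<le> t \<longrightarrow> p (t *\<^sub>R x) \<le> t * p x)"

lemma sublinear_add: "sublinear p \<Longrightarrow> p (x + y) \<le> p x + p y"
  by (simp add: sublinear_def)

lemma sublinear_scaleR_le: "sublinear p \<Longrightarrow> 0 \<le> t \<Longrightarrow> p (t *\<^sub>R x) \<le> t * p x"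
  by (simp add: sublinear_def)

lemma sublinear_zero:
  assumes "sublinear p"
  shows "p 0 = 0"
  using sublinear_add[OF assms, of 0 0] sublinear_scaleR_le[OF assms, of 0 0] by simp

text \<open>Scaling back by the inverse of t gives the converse inequality. The definition can
  therefore ask for the inequality only, which infima and distances inherit directly.\<close>

lemma sublinear_scaleR:
  assumes "sublinear p" "0 \<le> t"
  shows "p (t *\<^sub>R x) = t * p x"
proof (cases "t = 0")
  case True
  then show ?thesis by (simp add: sublinear_zero[OF assms(1)])
next
  case False
  with assms have "t > 0" by simp
  have "p x \<le> inverse t * p (t *\<^sub>R x)"
    using sublinear_scaleR_le[OF assms(1), of "inverse t" "t *\<^sub>R x"] \<open>t > 0\<close> by simp
  then have "t * p x \<le> p (t *\<^sub>R x)"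
    using \<open>t > 0\<close> by (simp add: field_simps)
  then show ?thesis
    using sublinear_scaleR_le[OF assms] by (simp add: antisym)
qed

lemma sublinear_minus_le:
  assumes "sublinear p"
  shows "- p (- x) \<le> p x"
  using sublinear_add[OF assms, of x "- x"] sublinear_zero[OF assms] by simp

text \<open>Here q is the infimum of p(x + t z) - t p(z) over t \<ge> 0. Taking t = 0 shows q \<le>
  p, and t = 1 at \<open>- z\<close> gives the required value; the lower bound - p(-x) keeps the
  infimum finite.\<close>

lemma sublinear_decrease:
  assumes p: "sublinear p"
  obtains q where "sublinear q" "\<And>x. q x \<le> p x" "q (- z) \<le> - p z"
proof
  define h where "h = (\<lambda>x t. p (x + t *\<^sub>R z) - t * p z)"
  define q where "q = (\<lambda>x. INF t\<in>{0..}. h x t)"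
  have lower: "- p (- x) \<le> h x t" if "t \<ge> 0" for x t
  proof -
    have "p (t *\<^sub>R z) \<le> p (x + t *\<^sub>R z) + p (- x)"
      using sublinear_add[OF p, of "x + t *\<^sub>R z" "- x"] by simp
    then show ?thesis
      using sublinear_scaleR[OF p that] by (simp add: h_def)
  qed
  have bdd: "bdd_below (h x ` {0..})" for x
    using lower by (auto intro!: bdd_belowI[where m = "- p (- x)"])
  have q_le: "q x \<le> h x t" if "t \<ge> 0" for x t
    unfolding q_def using that by (intro cINF_lower bdd) auto
  have le_q: "c \<le> q x" if "\<And>t. t \<ge> 0 \<Longrightarrow> c \<le> h x t" for c x
    unfolding q_def using that by (intro cINF_greatest) auto
  show "q x \<le> p x" for x
    using q_le[of 0 x] by (simp add: h_def)
  show "q (- z) \<le> - p z"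
    using q_le[of 1 "- z"] sublinear_zero[OF p] by (simp add: h_def)
  show "sublinear q"
    unfolding sublinear_def
  proof (intro conjI allI impI)
    fix x y
    have "q (x + y) - h x s \<le> h y t" if "s \<ge> 0" "t \<ge> 0" for s t
    proof -
      have "q (x + y) \<le> h (x + y) (s + t)"
        using that by (intro q_le) auto
      also have "\<dots> \<le> h x s + h y t"
        using sublinear_add[OF p, of "x + s *\<^sub>R z" "y + t *\<^sub>R z"]
        by (simp add: h_def algebra_simps)
      finally show ?thesis by simp
    qed
    then have "q (x + y) - h x s \<le> q y" if "s \<ge> 0" for s
      using that by (intro le_q) auto
    then have "q (x + y) - q y \<le> q x"
      by (intro le_q) (simp add: algebra_simps)
    then show "q (x + y) \<le> q x + q y" by simp
  next
    fix t :: real and x assume t: "0 \<le> t"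
    show "q (t *\<^sub>R x) \<le> t * q x"
    proof (cases "t = 0")
      case True
      then show ?thesis
        using q_le[of 0 0] sublinear_zero[OF p] by (simp add: h_def)
    next
      case False
      with t have "t > 0" by simp
      have "inverse t * q (t *\<^sub>R x) \<le> q x"
      proof (rule le_q)
        fix s :: real assume "s \<ge> 0"
        then have "q (t *\<^sub>R x) \<le> h (t *\<^sub>R x) (t * s)"
          using t by (intro q_le) auto
        also have "\<dots> = t * h x s"
          using sublinear_scaleR[OF p t, of "x + s *\<^sub>R z"] by (simp add: h_def algebra_simps)
        finally show "inverse t * q (t *\<^sub>R x) \<le> h x s"
          using \<open>t > 0\<close> by (simp add: field_simps)
      qed
      then show ?thesis
        using \<open>t > 0\<close> by (simp add: field_simps)
    qed
  qed
qed

text \<open>Subadditivity survives because any two members f, g of a chain have a common lower bound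
  in the chain, namely the smaller one, and its subadditivity bounds the infimum by f x + g
  y.\<close>

lemma sublinear_chain_Inf:
  assumes C: "C \<noteq> {}" "\<And>f. f \<in> C \<Longrightarrow> sublinear f"
    and chain: "\<And>f g. f \<in> C \<Longrightarrow> g \<in> C \<Longrightarrow> f \<le> g \<or> g \<le> f"
    and bdd: "\<And>x. bdd_below ((\<lambda>f. f x) ` C)"
  shows "sublinear (\<lambda>x. INF f\<in>C. f x)"
  unfolding sublinear_def
proof (intro conjI allI impI)
  define q where "q = (\<lambda>x. INF f\<in>C. f x)"
  have q_le: "q x \<le> f x" if "f \<in> C" for f x
    unfolding q_def using that by (intro cINF_lower bdd)
  have le_q: "c \<le> q x" if "\<And>f. f \<in> C \<Longrightarrow> c \<le> f x" for c x
    unfolding q_def using that C(1) by (intro cINF_greatest)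
  {
    fix x y
    have "q (x + y) - f x \<le> g y" if fg: "f \<in> C" "g \<in> C" for f g
    proof -
      obtain h where h: "h \<in> C" "h \<le> f" "h \<le> g"
        using chain[OF fg] fg by blast
      have "q (x + y) \<le> h x + h y"
        using q_le[OF h(1)] sublinear_add[OF C(2)[OF h(1)]] order_trans by blast
      then show ?thesis
        using h(2,3)[THEN le_funD] by (smt (verit))
    qed
    then have "q (x + y) - f x \<le> q y" if "f \<in> C" for f
      using that by (intro le_q)
    then have "q (x + y) - q y \<le> q x"
      by (intro le_q) (simp add: algebra_simps)
    then show "(INF f\<in>C. f (x + y)) \<le> (INF f\<in>C. f x) + (INF f\<in>C. f y)"
      by (simp add: q_def)
  }
  {
    fix t :: real and x assume t: "0 \<le> t"
    show "(INF f\<in>C. f (t *\<^sub>R x)) \<le> t * (INF f\<in>C. f x)"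
    proof (cases "t = 0")
      case True
      obtain f where "f \<in> C" using C(1) by auto
      then have "q 0 \<le> 0" using q_le sublinear_zero[OF C(2)] by metis
      with True show ?thesis by (simp add: q_def)
    next
      case False
      with t have "t > 0" by simp
      have "inverse t * q (t *\<^sub>R x) \<le> q x"
      proof (rule le_q)
        fix f assume f: "f \<in> C"
        have "q (t *\<^sub>R x) \<le> t * f x"
          using q_le[OF f, of "t *\<^sub>R x"] sublinear_scaleR[OF C(2)[OF f] t] by simp
        then show "inverse t * q (t *\<^sub>R x) \<le> f x"
          using \<open>t > 0\<close> by (simp add: field_simps)
      qed
      then show ?thesis
        using \<open>t > 0\<close> by (simp add: field_simps q_def)
    qed
  }
qed

text \<open>A minimal sublinear function is linear, because \<open>sublinear_decrease\<close> cannot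
  decrease it any further; this avoids extending functionals from subspaces.\<close>

lemma sublinear_dominates_linear:
  assumes p: "sublinear p"
  obtains f where "linear f" "\<And>x. f x \<le> p x"
proof -
  define S where "S = {q. sublinear q \<and> q \<le> p}"
  have lower: "- p (- x) \<le> q x" if "q \<in> S" for q x
    using sublinear_minus_le[of q x] that le_funD[of q p "- x"] by (simp add: S_def)
  \<comment> \<open>Zorn's lemma is applied to the reversed order, so that the bound required for a
    chain is its pointwise infimum and the maximal element is a minimal sublinear function.\<close>
  have "\<exists>m\<in>S. \<forall>f\<in>S. m \<ge> f \<longrightarrow> f = m"
  proof (rule predicate_Zorn)
    show "partial_order_on S (relation_of (\<ge>) S)"
      by (rule partial_order_on_relation_ofI) auto
    fix C assume C: "C \<in> Chains (relation_of (\<ge>) S)"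
    then have CS: "C \<subseteq> S" and chain: "\<And>f g. f \<in> C \<Longrightarrow> g \<in> C \<Longrightarrow> f \<le> g \<or> g \<le> f"
      by (auto simp: Chains_def relation_of_def)
    show "\<exists>u\<in>S. \<forall>a\<in>C. u \<le> a"
    proof (cases "C = {}")
      case True
      then show ?thesis using p by (auto simp: S_def)
    next
      case False
      have bdd: "bdd_below ((\<lambda>f. f x) ` C)" for x
        using lower CS by (auto intro!: bdd_belowI[where m = "- p (- x)"])
      define u where "u = (\<lambda>x. INF f\<in>C. f x)"
      have le: "u \<le> f" if "f \<in> C" for f
        unfolding u_def le_fun_def using that bdd by (auto intro!: cINF_lower)
      have "sublinear u"
        unfolding u_def using False CS chain bdd
        by (intro sublinear_chain_Inf) (auto simp: S_def)
      moreover obtain f where "f \<in> C" using False by auto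
      then have "u \<le> p" using le CS by (force simp: S_def)
      ultimately show ?thesis using le by (auto simp: S_def)
    qed
  qed
  then obtain m where m: "sublinear m" "m \<le> p"
    and min: "\<And>f. sublinear f \<Longrightarrow> f \<le> m \<Longrightarrow> f = m"
    unfolding S_def by (blast intro: order_trans)
  have neg: "m (- z) = - m z" for z
  proof -
    obtain q where q: "sublinear q" "\<And>x. q x \<le> m x" "q (- z) \<le> - m z"
      using sublinear_decrease[OF m(1)] by blast
    then have "q = m" by (intro min le_funI)
    then show ?thesis using q(3) sublinear_minus_le[OF m(1), of z] by simp
  qed
  show thesis
  proof
    show "linear m"
    proof
      show "m (x + y) = m x + m y" for x y
        using sublinear_add[OF m(1), of x y] sublinear_add[OF m(1), of "- x" "- y"] neg[of x]
          neg[of y] neg[of "x + y"] by simp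
      show "m (t *\<^sub>R x) = t *\<^sub>R m x" for t x
        using sublinear_scaleR[OF m(1), of t x] sublinear_scaleR[OF m(1), of "- t" x]
          neg[of "t *\<^sub>R x"] by (cases "t \<ge> 0") auto
    qed
    show "m x \<le> p x" for x using m(2) by (simp add: le_fun_def)
  qed
qed

text \<open>Lowering p to q beforehand forces the value at z: every linear f below q satisfies f(-z)
  \<le> - p(z), that is, f(z) \<ge> p(z).\<close>

theorem Hahn_Banach_sublinear:
  assumes p: "sublinear p"
  obtains f where "linear f" "\<And>x. f x \<le> p x" "f z = p z"
proof -
  obtain q where q: "sublinear q" "\<And>x. q x \<le> p x" "q (- z) \<le> - p z"
    using sublinear_decrease[OF p] by blast
  obtain f where f: "linear f" "\<And>x. f x \<le> q x"
    using sublinear_dominates_linear[OF q(1)] by blast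
  have "f z = p z"
    using f(2)[of z] f(2)[of "- z"] q(2)[of z] q(3) linear_neg[OF f(1), of z] by simp
  then show thesis
    using that f q(2) order_trans by blast
qed

section \<open>Functionals dominated by the distance from a subspace\<close>

lemma infdist_lessE:
  assumes "A \<noteq> {}" "infdist x A < e"
  obtains a where "a \<in> A" "dist x a < e"
proof -
  have "\<exists>d\<in>dist x ` A. d < e"
    using assms by (intro cInf_lessD) (auto simp: infdist_notempty)
  then show thesis using that by blast
qed

lemma sublinear_infdist:
  fixes F :: "'a::real_normed_vector set"
  assumes "subspace F"
  shows "sublinear (\<lambda>x. infdist x F)"
  unfolding sublinear_def
proof (intro conjI allI impI)
  have ne: "F \<noteq> {}" using subspace_0[OF assms] by auto
  fix x y :: 'a
  show "infdist (x + y) F \<le> infdist x F + infdist y F"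
  proof (rule field_le_epsilon)
    fix e :: real assume "e > 0"
    then obtain a b where ab: "a \<in> F" "dist x a < infdist x F + e / 2"
      "b \<in> F" "dist y b < infdist y F + e / 2"
      using infdist_lessE[OF ne] by (metis half_gt_zero less_add_same_cancel1)
    have "infdist (x + y) F \<le> dist (x + y) (a + b)"
      using ab assms by (intro infdist_le subspace_add)
    also have "\<dots> \<le> dist x a + dist y b"
      by (rule dist_triangle_add)
    finally show "infdist (x + y) F \<le> infdist x F + infdist y F + e"
      using ab by simp
  qed
next
  have ne: "F \<noteq> {}" using subspace_0[OF assms] by auto
  fix t :: real and x :: 'a assume t: "0 \<le> t"
  show "infdist (t *\<^sub>R x) F \<le> t * infdist x F"
  proof (cases "t = 0")
    case True
    then show ?thesis using subspace_0[OF assms] by simp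
  next
    case False
    with t have "t > 0" by simp
    show ?thesis
    proof (rule field_le_epsilon)
      fix e :: real assume "e > 0"
      then obtain a where a: "a \<in> F" "dist x a < infdist x F + e / t"
        using infdist_lessE[OF ne] \<open>t > 0\<close> by (metis divide_pos_pos less_add_same_cancel1)
      have "infdist (t *\<^sub>R x) F \<le> dist (t *\<^sub>R x) (t *\<^sub>R a)"
        using a assms by (intro infdist_le subspace_scale)
      also have "\<dots> = t * dist x a"
        using t by (simp add: dist_norm flip: scaleR_diff_right)
      also have "\<dots> \<le> t * (infdist x F + e / t)"
        using a t by (intro mult_left_mono) auto
      also have "\<dots> = t * infdist x F + e"
        using \<open>t > 0\<close> by (simp add: distrib_left)
      finally show "infdist (t *\<^sub>R x) F \<le> t * infdist x F + e" .
    qed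
  qed
qed

text \<open>The distance from F is the quotient seminorm. A linear functional below it vanishes on
  F, since x and -x both have distance 0 there, and is bounded by the norm, since 0 lies in
  F.\<close>

theorem Hahn_Banach_infdist:
  fixes F :: "'a::real_normed_vector set"
  assumes F: "subspace F"
  obtains f :: "'a \<Rightarrow> real"
  where "bounded_linear f" "\<And>x. \<bar>f x\<bar> \<le> norm x" "\<And>x. x \<in> F \<Longrightarrow> f x = 0" "f z = infdist z F"
proof -
  obtain f where f: "linear f" "\<And>x. f x \<le> infdist x F" "f z = infdist z F"
    using Hahn_Banach_sublinear[OF sublinear_infdist[OF F]] by blast
  have le: "f x \<le> norm x" for x
    using f(2)[of x] infdist_le[OF subspace_0[OF F], of x] by simp
  have abs: "\<bar>f x\<bar> \<le> norm x" for x
    using le[of x] le[of "- x"] linear_neg[OF f(1), of x] by simp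
  show thesis
  proof (rule that[OF _ abs _ f(3)])
    show "bounded_linear f"
      using f(1) abs by (auto simp: bounded_linear_def bounded_linear_axioms_def intro: exI[of _ 1])
    show "f x = 0" if "x \<in> F" for x
      using f(2)[of x] f(2)[of "- x"] linear_neg[OF f(1), of x] that subspace_neg[OF F that] by simp
  qed
qed

corollary norming_functional:
  fixes z :: "'a::real_normed_vector"
  obtains f :: "'a \<Rightarrow> real"
  where "bounded_linear f" "\<And>x. \<bar>f x\<bar> \<le> norm x" "f z = norm z"
proof -
  obtain f :: "'a \<Rightarrow> real" where "bounded_linear f" "\<And>x. \<bar>f x\<bar> \<le> norm x" "f z = infdist z {0}"
    using Hahn_Banach_infdist[OF subspace_single_0] by metis
  then show thesis using that[of f] by simp
qed

section \<open>Compactness of balls in finite-dimensional subspaces\<close>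

lemma closed_if_compact_Int_cball:
  fixes S :: "'a::real_normed_vector set"
  assumes "\<And>R. compact (S \<inter> cball 0 R)"
  shows "closed S"
  unfolding closed_sequential_limits
proof (intro allI impI)
  fix x l assume x: "(\<forall>n. x n \<in> S) \<and> x \<longlonglongrightarrow> l"
  then have "bounded (range x)"
    by (auto intro: convergent_imp_bounded)
  then obtain R where R: "\<And>n. norm (x n) \<le> R"
    unfolding bounded_iff by blast
  have "closed (S \<inter> cball 0 R)"
    using assms by (rule compact_imp_closed)
  then have "l \<in> S \<inter> cball 0 R"
    by (rule closed_sequentially[of _ x]) (use x R in simp_all)
  then show "l \<in> S" by simp
qed

text \<open>Induction on the spanning set. A new vector b has positive distance d from the closed
  subspace \<open>span B\<close>, which bounds its coefficient in any vector of norm at most R by R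
  / d. The ball is thus a closed part of a continuous image of a compact product.\<close>

lemma compact_span_Int_cball:
  fixes B :: "'a::real_normed_vector set"
  assumes "finite B"
  shows "compact (span B \<inter> cball 0 R)"
  using assms
proof (induction B arbitrary: R)
  case empty
  have "compact ({0::'a} \<inter> cball 0 R)" by (intro compact_Int_closed) auto
  then show ?case by simp
next
  case (insert b B)
  have cl: "closed (span B)"
    using insert.IH by (rule closed_if_compact_Int_cball)
  show ?case
  proof (cases "b \<in> span B")
    case True
    then show ?thesis using insert.IH by (simp add: span_redundant)
  next
    case False
    define d where "d = infdist b (span B)"
    have "d > 0"
      unfolding d_def using False cl span_zero by (intro infdist_pos_not_in_closed) auto
    define M where "M = R / d"
    define K where "K = (\<lambda>(c, v). c *\<^sub>R b + v) ` ({-M..M} \<times> (span B \<inter> cball 0 (R + M * norm b)))"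
    have "compact K"
      unfolding K_def case_prod_beta
      by (intro compact_continuous_image compact_Times insert.IH continuous_intros compact_Icc)
    moreover have "span (insert b B) \<inter> cball 0 R = K \<inter> cball 0 R"
    proof (intro equalityI subsetI)
      fix u assume u: "u \<in> span (insert b B) \<inter> cball 0 R"
      then obtain c where c: "u - c *\<^sub>R b \<in> span B"
        using span_breakdown_eq[of u b B] by blast
      define v where "v = u - c *\<^sub>R b"
      have "\<bar>c\<bar> * d \<le> R"
      proof (cases "c = 0")
        case True
        then show ?thesis using u order_trans[OF norm_ge_zero[of u], of R] by simp
      next
        case False
        \<comment> \<open>After division by c, the vector u is the difference of b and a point of
          \<open>span B\<close>, so its norm is at least d.\<close>
        have "d \<le> dist b (- (inverse c *\<^sub>R v))"
          unfolding d_def using c by (intro infdist_le) (auto simp: v_def intro: span_neg span_scale)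
        then have "\<bar>c\<bar> * d \<le> \<bar>c\<bar> * dist b (- (inverse c *\<^sub>R v))"
          by (intro mult_left_mono) auto
        also have "\<dots> = norm (c *\<^sub>R (b + inverse c *\<^sub>R v))"
          by (simp add: dist_norm)
        also have "\<dots> = norm u"
          using False by (simp add: v_def scaleR_add_right)
        also have "\<dots> \<le> R" using u by simp
        finally show ?thesis .
      qed
      then have cM: "\<bar>c\<bar> \<le> M"
        using \<open>d > 0\<close> by (simp add: M_def field_simps)
      have "norm v \<le> norm u + \<bar>c\<bar> * norm b"
        unfolding v_def by (metis norm_scaleR norm_triangle_ineq4)
      also have "\<dots> \<le> R + M * norm b"
        using u cM by (intro add_mono mult_right_mono) auto
      finally have "(c, v) \<in> {-M..M} \<times> (span B \<inter> cball 0 (R + M * norm b))"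
        using c cM by (auto simp: v_def)
      moreover have "u = c *\<^sub>R b + v" by (simp add: v_def)
      ultimately show "u \<in> K \<inter> cball 0 R"
        using u unfolding K_def by (intro IntI rev_image_eqI[of "(c, v)"]) auto
    next
      fix u assume u: "u \<in> K \<inter> cball 0 R"
      then obtain c v where "u = c *\<^sub>R b + v" "v \<in> span B"
        by (auto simp: K_def)
      then have "u - c *\<^sub>R b \<in> span B" by simp
      then show "u \<in> span (insert b B) \<inter> cball 0 R"
        using u span_breakdown_eq[of u b B] by blast
    qed
    ultimately show ?thesis by (simp add: compact_Int_closed)
  qed
qed

section \<open>The Orlicz--Pettis theorem\<close>

text \<open>Here z is a weak sum of the subseries over S. The bound does not mention S, so for fixed
  f one N serves all subseries.\<close>

lemma functional_partial_sum_error: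
  fixes y :: "nat \<Rightarrow> 'a::real_normed_vector" and f :: "'a \<Rightarrow> real"
  assumes f: "bounded_linear f" and abs: "summable (\<lambda>n. \<bar>f (y n)\<bar>)"
    and z: "f z = (\<Sum>n. indicator S n * f (y n))"
  shows "\<bar>f z - f (sum y (S \<inter> {..<N}))\<bar> \<le> (\<Sum>n. \<bar>f (y (n + N))\<bar>)"
proof -
  define h where "h = (\<lambda>n. indicator S n * f (y n))"
  have h_le: "\<bar>h n\<bar> \<le> \<bar>f (y n)\<bar>" for n
    by (simp add: h_def indicator_def)
  have abs_h: "summable (\<lambda>n. \<bar>h n\<bar>)"
    using h_le by (intro summable_comparison_test'[OF abs, of 0]) auto
  have "f z = (\<Sum>n. h (n + N)) + sum h {..<N}"
    unfolding z h_def[symmetric]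
    using abs_h by (intro suminf_split_initial_segment) (rule summable_rabs_cancel)
  moreover have "f (sum y (S \<inter> {..<N})) = sum h {..<N}"
  proof -
    have "f (sum y (S \<inter> {..<N})) = (\<Sum>n\<in>{..<N} \<inter> S. f (y n))"
      using linear_sum[OF bounded_linear.linear[OF f]] by (simp add: Int_commute)
    also have "\<dots> = sum h {..<N}"
      unfolding sum.inter_restrict[OF finite_lessThan] by (intro sum.cong) (auto simp: h_def)
    finally show ?thesis .
  qed
  ultimately have "\<bar>f z - f (sum y (S \<inter> {..<N}))\<bar> = \<bar>\<Sum>n. h (n + N)\<bar>"
    by simp
  also have "\<dots> \<le> (\<Sum>n. \<bar>h (n + N)\<bar>)"
    using abs_h by (intro summable_rabs) (simp add: summable_iff_shift[of "\<lambda>n. \<bar>h n\<bar>"])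
  also have "\<dots> \<le> (\<Sum>n. \<bar>f (y (n + N))\<bar>)"
    using abs abs_h h_le
    by (intro suminf_le)
       (simp_all add: summable_iff_shift[of "\<lambda>n. \<bar>h n\<bar>"] summable_iff_shift[of "\<lambda>n. \<bar>f (y n)\<bar>"])
  finally show ?thesis .
qed

text \<open>A finite block is its own weak sum, with S = A, and its part below N is empty.\<close>

lemma functional_block_le:
  fixes y :: "nat \<Rightarrow> 'a::real_normed_vector" and f :: "'a \<Rightarrow> real"
  assumes f: "bounded_linear f" and abs: "summable (\<lambda>n. \<bar>f (y n)\<bar>)"
    and A: "finite A" "A \<subseteq> {N..}"
  shows "\<bar>f (sum y A)\<bar> \<le> (\<Sum>n. \<bar>f (y (n + N))\<bar>)"
proof -
  have "f (sum y A) = (\<Sum>n\<in>A. indicator A n * f (y n))"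
    using linear_sum[OF bounded_linear.linear[OF f]] by simp
  also have "\<dots> = (\<Sum>n. indicator A n * f (y n))"
    by (rule suminf_finite[symmetric]) (use A in auto)
  finally have "\<bar>f (sum y A) - f (sum y (A \<inter> {..<N}))\<bar> \<le> (\<Sum>n. \<bar>f (y (n + N))\<bar>)"
    by (rule functional_partial_sum_error[OF f abs])
  moreover have "A \<inter> {..<N} = {}" using A by auto
  ultimately show ?thesis
    using linear_0[OF bounded_linear.linear[OF f]] by simp
qed

lemma functional_tail_less:
  fixes h :: "nat \<Rightarrow> real"
  assumes "summable (\<lambda>n. \<bar>h n\<bar>)" "e > 0"
  obtains N where "\<And>n. n \<ge> N \<Longrightarrow> (\<Sum>k. \<bar>h (k + n)\<bar>) < e"
proof -
  obtain N where "\<And>n. n \<ge> N \<Longrightarrow> norm (\<Sum>k. \<bar>h (k + n)\<bar>) < e"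
    using suminf_exist_split[OF assms(2,1)] by blast
  then show thesis using that by (metis abs_le_D1 real_norm_def order_le_less_trans order_refl)
qed

text \<open>Block sums far out are weakly small, so by compactness of balls in the finite-dimensional
  space \<open>span B\<close> they cannot stay close to it without being small in norm.\<close>

lemma block_far_from_span:
  fixes y :: "nat \<Rightarrow> 'a::real_normed_vector"
  assumes abs: "\<And>f :: 'a \<Rightarrow> real. bounded_linear f \<Longrightarrow> summable (\<lambda>n. \<bar>f (y n)\<bar>)"
    and blocks: "\<And>N. \<exists>A. finite A \<and> A \<subseteq> {N..} \<and> e \<le> norm (sum y A)"
    and e: "e > 0" and B: "finite B"
  obtains A where "finite A" "A \<subseteq> {N..}" "e / 4 \<le> infdist (sum y A) (span B)"
proof (rule ccontr)
  assume contra: "\<not> thesis"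
  obtain A where A: "\<And>k. finite (A k)" "\<And>k. A k \<subseteq> {k..}" "\<And>k. e \<le> norm (sum y (A k))"
    using blocks by metis
  \<comment> \<open>Rescaling to norm exactly e makes the blocks bounded, as compactness requires.
    The factors are at most 1, so neither the distances from \<open>span B\<close> nor the values of
    functionals grow.\<close>
  define c where "c = (\<lambda>k. e / norm (sum y (A (k + N))))"
  define w where "w = (\<lambda>k. c k *\<^sub>R sum y (A (k + N)))"
  have pos: "norm (sum y (A k)) > 0" for k
    using A(3)[of k] e by linarith
  have c: "0 \<le> c k" "c k \<le> 1" for k
    using A(3)[of "k + N"] e pos[of "k + N"] unfolding c_def by (auto simp: divide_le_eq_1)
  have norm_w: "norm (w k) = e" for k
    using pos[of "k + N"] e by (simp add: w_def c_def)
  have "\<exists>v\<in>span B. dist (w k) v < e / 4" for k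
  proof -
    have "infdist (sum y (A (k + N))) (span B) < e / 4"
      using A(1,2)[of "k + N"] contra that by (metis atLeast_subset_iff le_add2 not_le_imp_less subset_trans)
    moreover have "infdist (w k) (span B) = c k * infdist (sum y (A (k + N))) (span B)"
      unfolding w_def using c(1) by (intro sublinear_scaleR sublinear_infdist subspace_span)
    moreover have "c k * infdist (sum y (A (k + N))) (span B) \<le> infdist (sum y (A (k + N))) (span B)"
      using c[of k] by (intro mult_left_le_one_le) (auto simp: infdist_nonneg)
    ultimately have "infdist (w k) (span B) < e / 4" by linarith
    then show ?thesis
      using infdist_lessE[of "span B" "w k" "e / 4"] span_zero by blast
  qed
  then obtain v where v: "\<And>k. v k \<in> span B" "\<And>k. dist (w k) (v k) < e / 4"
    by metis
  have norm_v: "3 * e / 4 \<le> norm (v k)" "norm (v k) \<le> 2 * e" for k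
    using v(2)[of k] norm_w[of k] norm_triangle_ineq3[of "w k" "v k"] e
    unfolding dist_norm by linarith+
  have "compact (span B \<inter> cball 0 (2 * e))"
    using B by (rule compact_span_Int_cball)
  moreover have "\<forall>k. v k \<in> span B \<inter> cball 0 (2 * e)"
    using v(1) norm_v(2) by simp
  ultimately obtain l r where r: "strict_mono (r :: nat \<Rightarrow> nat)" and l: "(v \<circ> r) \<longlonglongrightarrow> l"
    unfolding compact_def by blast
  \<comment> \<open>The contradiction: in norm the limit keeps e - e/4, while its norming functional
    is at most e/4 on the rescaled blocks and changes by less than e/4 in passing to the
    \<open>v k\<close>, which leaves e/2.\<close>
  have norm_l: "3 * e / 4 \<le> norm l"
    using tendsto_norm[OF l] by (rule LIMSEQ_le_const) (use norm_v in auto)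
  obtain f :: "'a \<Rightarrow> real" where f: "bounded_linear f" "\<And>x. \<bar>f x\<bar> \<le> norm x" "f l = norm l"
    using norming_functional by blast
  obtain M where M: "\<And>n. n \<ge> M \<Longrightarrow> (\<Sum>k. \<bar>f (y (k + n))\<bar>) < e / 4"
    using functional_tail_less[OF abs[OF f(1)], of "e / 4"] e by auto
  have "f (v (r n)) \<le> e / 2" if "n \<ge> M" for n
  proof -
    have "r n + N \<ge> M"
      using seq_suble[OF r, of n] that by linarith
    then have "\<bar>f (sum y (A (r n + N)))\<bar> < e / 4"
      using functional_block_le[OF f(1) abs[OF f(1)] A(1,2)] M by (meson order_le_less_trans)
    moreover have "\<bar>f (w (r n))\<bar> = c (r n) * \<bar>f (sum y (A (r n + N)))\<bar>"
      using c(1)[of "r n"] linear_cmul[OF bounded_linear.linear[OF f(1)]] by (simp add: w_def abs_mult)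
    moreover have "\<dots> \<le> \<bar>f (sum y (A (r n + N)))\<bar>"
      using c[of "r n"] by (intro mult_left_le_one_le) auto
    moreover have "\<bar>f (w (r n)) - f (v (r n))\<bar> < e / 4"
      using f(2)[of "w (r n) - v (r n)"] v(2)[of "r n"]
        linear_diff[OF bounded_linear.linear[OF f(1)]] by (simp add: dist_norm)
    ultimately show ?thesis by linarith
  qed
  moreover have "(\<lambda>n. f (v (r n))) \<longlonglongrightarrow> f l"
    using bounded_linear.tendsto[OF f(1) l] by (simp add: o_def)
  ultimately have "f l \<le> e / 2"
    by (intro LIMSEQ_le_const2) auto
  then show False
    using norm_l f(3) e by simp
qed

text \<open>Hahn-Banach for the distance from \<open>span B\<close> turns a block far from that span
  into the functional f. The new index N' lies beyond the block and beyond the point where the tail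
  of f drops below e/16.\<close>

lemma gliding_hump_step:
  fixes y :: "nat \<Rightarrow> 'a::real_normed_vector"
  assumes abs: "\<And>f :: 'a \<Rightarrow> real. bounded_linear f \<Longrightarrow> summable (\<lambda>n. \<bar>f (y n)\<bar>)"
    and blocks: "\<And>N. \<exists>A. finite A \<and> A \<subseteq> {N..} \<and> e \<le> norm (sum y A)"
    and e: "e > 0" and B: "finite B"
  shows "\<exists>N' A. \<exists>f :: 'a \<Rightarrow> real. N < N' \<and> A \<subseteq> {N..<N'} \<and> bounded_linear f \<and>
    (\<forall>x. \<bar>f x\<bar> \<le> norm x) \<and> (\<forall>x\<in>B. f x = 0) \<and> e / 4 \<le> f (sum y A) \<and>
    (\<Sum>n. \<bar>f (y (n + N'))\<bar>) < e / 16"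
proof -
  obtain A where A: "finite A" "A \<subseteq> {N..}" "e / 4 \<le> infdist (sum y A) (span B)"
    using block_far_from_span[OF abs blocks e B] by blast
  obtain f :: "'a \<Rightarrow> real" where f: "bounded_linear f" "\<And>x. \<bar>f x\<bar> \<le> norm x"
    "\<And>x. x \<in> span B \<Longrightarrow> f x = 0" "f (sum y A) = infdist (sum y A) (span B)"
    using Hahn_Banach_infdist[OF subspace_span] by blast
  obtain M where M: "\<And>n. n \<ge> M \<Longrightarrow> (\<Sum>k. \<bar>f (y (k + n))\<bar>) < e / 16"
    using functional_tail_less[OF abs[OF f(1)], of "e / 16"] e by auto
  obtain K where K: "A \<subseteq> {..<K}"
    using A(1) by (metis finite_nat_iff_bounded)
  have "A \<subseteq> {N..<max (max M K) (Suc N)}"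
    using A(2) K by fastforce
  with A(3) f M show ?thesis
    by (intro exI[of _ "max (max M K) (Suc N)"] exI[of _ A] exI[of _ f]) (simp add: span_base)
qed

text \<open>Gliding hump: blocks with norm at least \<open>e\<close> are chosen together with functionals of norm
  at most one that annihilate the earlier blocks and almost annihilate the later ones. The sum of
  all the blocks lies in the closed span of the blocks, although every one of the functionals
  is bounded away from zero there.\<close>

theorem Orlicz_Pettis:
  fixes y :: "nat \<Rightarrow> 'a::real_normed_vector"
  assumes abs: "\<And>f :: 'a \<Rightarrow> real. bounded_linear f \<Longrightarrow> summable (\<lambda>n. \<bar>f (y n)\<bar>)"
    and sub: "\<And>S. \<exists>z. \<forall>f :: 'a \<Rightarrow> real. bounded_linear f \<longrightarrow> f z = (\<Sum>n. indicator S n * f (y n))"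
    and e: "e > 0"
  obtains N where "\<And>A. finite A \<Longrightarrow> A \<subseteq> {N..} \<Longrightarrow> norm (sum y A) < e"
proof (rule ccontr)
  assume contra: "\<not> thesis"
  have blocks: "\<exists>A. finite A \<and> A \<subseteq> {N..} \<and> e \<le> norm (sum y A)" for N
    using contra that by (meson not_le_imp_less)
  \<comment> \<open>A state records the index reached, all block sums so far, and the latest block
    with its functional. The initial block and functional are dummies, which is why \<open>D\<close>
    and \<open>\<phi>\<close> read them off from \<open>s (Suc n)\<close>.\<close>
  define Q where "Q = (\<lambda>(s :: nat \<times> 'a set \<times> nat set \<times> ('a \<Rightarrow> real)) s'.
    case s of (N, B, _, _) \<Rightarrow> case s' of (N', B', A, f) \<Rightarrow>
      N < N' \<and> A \<subseteq> {N..<N'} \<and> bounded_linear f \<and>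
      (\<forall>x. \<bar>f x\<bar> \<le> norm x) \<and> (\<forall>x\<in>B. f x = 0) \<and> e / 4 \<le> f (sum y A) \<and>
      (\<Sum>n. \<bar>f (y (n + N'))\<bar>) < e / 16 \<and> B' = insert (sum y A) B)"
  have "\<exists>s. \<forall>n. finite (fst (snd (s n))) \<and> Q (s n) (s (Suc n))"
  proof (rule dependent_nat_choice)
    show "\<exists>s :: nat \<times> 'a set \<times> nat set \<times> ('a \<Rightarrow> real). finite (fst (snd s))"
      by (intro exI[of _ "(0, {}, {}, \<lambda>_. 0)"]) simp
    fix s :: "nat \<times> 'a set \<times> nat set \<times> ('a \<Rightarrow> real)" and n :: nat
    assume fin: "finite (fst (snd s))"
    obtain N B A0 f0 where s: "s = (N, B, A0, f0)" by (metis prod_cases4)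
    have "finite B" using fin s by simp
    from gliding_hump_step[OF abs blocks e this, of N]
    obtain N' A and f :: "'a \<Rightarrow> real" where "N < N'" "A \<subseteq> {N..<N'}" "bounded_linear f"
      "\<forall>x. \<bar>f x\<bar> \<le> norm x" "\<forall>x\<in>B. f x = 0" "e / 4 \<le> f (sum y A)"
      "(\<Sum>n. \<bar>f (y (n + N'))\<bar>) < e / 16"
      by blast
    with \<open>finite B\<close> show "\<exists>s'. finite (fst (snd s')) \<and> Q s s'"
      by (intro exI[of _ "(N', insert (sum y A) B, A, f)"]) (simp add: Q_def s)
  qed
  then obtain s where Qs: "\<And>n. Q (s n) (s (Suc n))" by blast
  define N where "N = (\<lambda>n. fst (s n))"
  define B where "B = (\<lambda>n. fst (snd (s n)))"
  define D where "D = (\<lambda>n. fst (snd (snd (s (Suc n)))))"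
  define \<phi> where "\<phi> = (\<lambda>n. snd (snd (snd (s (Suc n)))))"
  define u where "u = (\<lambda>n. sum y (D n))"
  have N_Suc: "N n < N (Suc n)" and D: "D n \<subseteq> {N n..<N (Suc n)}"
    and \<phi>: "bounded_linear (\<phi> n)" and \<phi>_le: "\<bar>\<phi> n x\<bar> \<le> norm x"
    and \<phi>_B: "x \<in> B n \<Longrightarrow> \<phi> n x = 0" and \<phi>_u: "e / 4 \<le> \<phi> n (u n)"
    and \<phi>_tail: "(\<Sum>k. \<bar>\<phi> n (y (k + N (Suc n)))\<bar>) < e / 16"
    and B_Suc: "B (Suc n) = insert (u n) (B n)" for n x
    using Qs[of n] unfolding Q_def N_def B_def D_def \<phi>_def u_def case_prod_beta by blast+
  have N_strict: "strict_mono N"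
    using N_Suc by (simp add: strict_mono_Suc_iff)
  then have N_mono: "N i \<le> N j" if "i \<le> j" for i j
    using that by (simp add: strict_mono_less_eq)
  have B_mono: "B i \<subseteq> B j" if "i \<le> j" for i j
    by (rule lift_Suc_mono_le[of B, OF _ that]) (simp only: B_Suc subset_insertI)
  have \<phi>_earlier: "\<phi> n (u j) = 0" if "j < n" for n j
    using \<phi>_B[of "u j" n] B_mono[of "Suc j" n] that B_Suc[of j] by auto
  \<comment> \<open>The blocks occupy successive index ranges, so cutting S at \<open>N m\<close>
    leaves exactly the first m blocks.\<close>
  define S where "S = (\<Union>n. D n)"
  have S_slice: "S \<inter> {N m..<N (Suc m)} = D m" for m
  proof
    show "D m \<subseteq> S \<inter> {N m..<N (Suc m)}" using D[of m] by (auto simp: S_def)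
    show "S \<inter> {N m..<N (Suc m)} \<subseteq> D m"
    proof
      fix i assume i: "i \<in> S \<inter> {N m..<N (Suc m)}"
      then obtain j where j: "i \<in> D j" by (auto simp: S_def)
      have "j = m"
        using i j D[of j] N_mono[of "Suc j" m] N_mono[of "Suc m" j]
        by (metis IntD2 Suc_leI atLeastLessThan_iff leD le_less_trans less_le_trans linorder_neqE_nat subsetD)
      with j show "i \<in> D m" by simp
    qed
  qed
  have S_sum: "sum y (S \<inter> {..<N m}) = sum u {..<m}" for m
  proof (induction m)
    case 0
    have "N 0 \<le> i" if i: "i \<in> S" for i
    proof -
      obtain j where "i \<in> D j" using i by (auto simp: S_def)
      then show ?thesis using D[of j] N_mono[of 0 j] by auto
    qed
    then have "S \<inter> {..<N 0} = {}" by (auto simp flip: not_less)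
    then show ?case by simp
  next
    case (Suc m)
    have "S \<inter> {..<N (Suc m)} = (S \<inter> {..<N m}) \<union> D m"
      unfolding S_slice[of m, symmetric] using N_Suc[of m] by auto
    moreover have "(S \<inter> {..<N m}) \<inter> D m = {}"
      unfolding S_slice[of m, symmetric] by auto
    moreover have "finite (D m)"
      using D[of m] finite_subset by blast
    ultimately show ?case
      using Suc by (simp add: sum.union_disjoint u_def)
  qed
  obtain z where z: "\<And>f :: 'a \<Rightarrow> real. bounded_linear f \<Longrightarrow> f z = (\<Sum>n. indicator S n * f (y n))"
    using sub by blast
  have approx: "\<bar>f z - (\<Sum>j<m. f (u j))\<bar> \<le> (\<Sum>n. \<bar>f (y (n + N m))\<bar>)"
    if "bounded_linear f" for f :: "'a \<Rightarrow> real" and m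
    using functional_partial_sum_error[OF that abs[OF that] z[OF that], of "N m"]
      linear_sum[OF bounded_linear.linear[OF that], of u "{..<m}"] by (simp add: S_sum)
  \<comment> \<open>The earlier blocks are annihilated, the m-th contributes at least e/4, and all
    later ones together cost less than e/16.\<close>
  have \<phi>_z: "3 * e / 16 \<le> \<phi> m z" for m
  proof -
    have "(\<Sum>j<Suc m. \<phi> m (u j)) = \<phi> m (u m)"
      using \<phi>_earlier by simp
    then show ?thesis
      using approx[OF \<phi>, of m "Suc m"] \<phi>_tail[of m] \<phi>_u[of m] by linarith
  qed
  \<comment> \<open>A functional vanishing on all blocks has zero partial sums along
    \<open>N m\<close>, so its value at z is bounded by arbitrarily small tails.\<close>
  have "infdist z (span (range u)) = 0"
  proof (rule ccontr)
    assume "infdist z (span (range u)) \<noteq> 0"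
    moreover obtain f :: "'a \<Rightarrow> real" where f: "bounded_linear f" "\<And>x. x \<in> span (range u) \<Longrightarrow> f x = 0"
      "f z = infdist z (span (range u))"
      using Hahn_Banach_infdist[OF subspace_span] by metis
    ultimately have pos: "f z > 0" using infdist_nonneg by (metis order_le_less)
    obtain M where M: "\<And>n. n \<ge> M \<Longrightarrow> (\<Sum>k. \<bar>f (y (k + n))\<bar>) < f z"
      using functional_tail_less[OF abs[OF f(1)] pos] by blast
    have "(\<Sum>j<M. f (u j)) = 0"
      using f(2) by (simp add: span_base)
    then show False
      using approx[OF f(1), of M] M[of "N M"] seq_suble[OF N_strict, of M] by simp
  qed
  then obtain v where v: "v \<in> span (range u)" "dist z v < e / 8"
    using infdist_lessE[of "span (range u)" z "e / 8"] span_zero e by auto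
  \<comment> \<open>Each block sum is annihilated by all later functionals, hence so is each vector
    of the span from some index on. Such a v within e/8 of z contradicts the lower bound
    3e/16.\<close>
  have "subspace {x. \<exists>m. \<forall>n\<ge>m. \<phi> n x = 0}"
  proof (rule subspaceI)
    have \<phi>_linear: "linear (\<phi> n)" for n using \<phi> by (rule bounded_linear.linear)
    show "0 \<in> {x. \<exists>m. \<forall>n\<ge>m. \<phi> n x = 0}"
      using linear_0[OF \<phi>_linear] by simp
    fix x x' assume "x \<in> {x. \<exists>m. \<forall>n\<ge>m. \<phi> n x = 0}" "x' \<in> {x. \<exists>m. \<forall>n\<ge>m. \<phi> n x = 0}"
    then obtain m m' where "\<forall>n\<ge>m. \<phi> n x = 0" "\<forall>n\<ge>m'. \<phi> n x' = 0" by blast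
    then show "x + x' \<in> {x. \<exists>m. \<forall>n\<ge>m. \<phi> n x = 0}"
      using linear_add[OF \<phi>_linear] by (auto intro!: exI[of _ "max m m'"])
  next
    fix c x assume "x \<in> {x. \<exists>m. \<forall>n\<ge>m. \<phi> n x = 0}"
    then show "c *\<^sub>R x \<in> {x. \<exists>m. \<forall>n\<ge>m. \<phi> n x = 0}"
      using linear_cmul[OF bounded_linear.linear[OF \<phi>]] by auto
  qed
  moreover have "range u \<subseteq> {x. \<exists>m. \<forall>n\<ge>m. \<phi> n x = 0}"
  proof (rule image_subsetI)
    fix j
    have "\<forall>n\<ge>Suc j. \<phi> n (u j) = 0" using \<phi>_earlier by simp
    then show "u j \<in> {x. \<exists>m. \<forall>n\<ge>m. \<phi> n x = 0}" by blast
  qed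
  ultimately have "span (range u) \<subseteq> {x. \<exists>m. \<forall>n\<ge>m. \<phi> n x = 0}"
    by (intro span_minimal)
  then obtain m where m: "\<phi> m v = 0"
    using v(1) by blast
  have "\<phi> m z = \<phi> m (z - v)"
    using linear_diff[OF bounded_linear.linear[OF \<phi>]] m by simp
  also have "\<dots> < e / 8"
    using \<phi>_le[of m "z - v"] v(2) by (simp add: dist_norm)
  finally show False
    using \<phi>_z[of m] e by simp
qed

section \<open>Sums with coefficients in the unit cube\<close>

text \<open>For \<^const>\<open>infdist\<close>-free upper bounds on \<^const>\<open>hausdorff_dist\<close>.\<close>

lemma hausdorff_dist_le:
  assumes "A \<noteq> {}" "B \<noteq> {}"
    and "\<And>a. a \<in> A \<Longrightarrow> \<exists>b\<in>B. dist a b \<le> r"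
    and "\<And>b. b \<in> B \<Longrightarrow> \<exists>a\<in>A. dist a b \<le> r"
  shows "hausdorff_dist A B \<le> r"
proof -
  have "infdist a B \<le> r" if "a \<in> A" for a
    using assms(3)[OF that] infdist_le2 by blast
  moreover have "infdist b A \<le> r" if "b \<in> B" for b
    using assms(4)[OF that] infdist_le2 by (metis dist_commute)
  ultimately show ?thesis
    unfolding hausdorff_dist_def using assms(1,2) by (auto intro!: cSUP_least)
qed

definition unconditionally_Cauchy :: "(nat \<Rightarrow> 'a::real_normed_vector) \<Rightarrow> bool" where
  "unconditionally_Cauchy y \<longleftrightarrow>
    (\<forall>e>0. \<exists>N. \<forall>A. finite A \<longrightarrow> A \<subseteq> {N..} \<longrightarrow> norm (sum y A) < e)"

text \<open>A sum with coefficients in \<open>[0,1]\<close> is a convex combination of subsums.\<close>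

lemma norm_cube_combination_le:
  fixes y :: "'i \<Rightarrow> 'a::real_normed_vector"
  assumes "finite A" and "\<And>i. i \<in> A \<Longrightarrow> s i \<in> {0..1}"
    and "\<And>B. B \<subseteq> A \<Longrightarrow> norm (v + sum y B) \<le> e"
  shows "norm (v + (\<Sum>i\<in>A. s i *\<^sub>R y i)) \<le> e"
  using assms
proof (induction A arbitrary: v)
  case empty
  then show ?case by simp
next
  case (insert a A)
  have s: "s a \<in> {0..1}" using insert.prems by simp
  \<comment> \<open>The coefficient \<open>s a\<close> interpolates between omitting
    \<open>y a\<close> and absorbing it into the offset; this is why v is arbitrary in the
    induction.\<close>
  have "norm (v + (\<Sum>i\<in>A. s i *\<^sub>R y i)) \<le> e"
    using insert.prems by (intro insert.IH) auto
  moreover have "norm ((v + y a) + (\<Sum>i\<in>A. s i *\<^sub>R y i)) \<le> e"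
  proof (intro insert.IH)
    fix B assume B: "B \<subseteq> A"
    then have "finite B" "a \<notin> B"
      using insert.hyps finite_subset by auto
    then show "norm ((v + y a) + sum y B) \<le> e"
      using insert.prems(2)[of "insert a B"] B by (auto simp: add.assoc)
  qed (use insert.prems in auto)
  ultimately have "(1 - s a) *\<^sub>R (v + (\<Sum>i\<in>A. s i *\<^sub>R y i))
      + s a *\<^sub>R ((v + y a) + (\<Sum>i\<in>A. s i *\<^sub>R y i)) \<in> cball 0 e"
    using s by (intro convexD[OF convex_cball]) auto
  moreover have "(1 - s a) *\<^sub>R (v + (\<Sum>i\<in>A. s i *\<^sub>R y i))
      + s a *\<^sub>R ((v + y a) + (\<Sum>i\<in>A. s i *\<^sub>R y i)) = v + (\<Sum>i\<in>insert a A. s i *\<^sub>R y i)"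
    using insert.hyps by (simp add: algebra_simps)
  ultimately show ?case by simp
qed

lemma unconditionally_Cauchy_cube:
  assumes "unconditionally_Cauchy y" "e > 0"
  obtains N where "\<And>A s. finite A \<Longrightarrow> A \<subseteq> {N..} \<Longrightarrow> (\<And>n. s n \<in> {0..1::real}) \<Longrightarrow>
    norm (\<Sum>n\<in>A. s n *\<^sub>R y n) \<le> e"
proof -
  obtain N where N: "\<And>A. finite A \<Longrightarrow> A \<subseteq> {N..} \<Longrightarrow> norm (sum y A) < e"
    using assms unfolding unconditionally_Cauchy_def by blast
  have "norm (\<Sum>n\<in>A. s n *\<^sub>R y n) \<le> e"
    if "finite A" "A \<subseteq> {N..}" "\<And>n. s n \<in> {0..1}" for A and s :: "nat \<Rightarrow> real"
  proof -
    have "norm (sum y B) \<le> e" if "B \<subseteq> A" for B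
      using N[of B] that \<open>finite A\<close> \<open>A \<subseteq> {N..}\<close> finite_subset by fastforce
    then show ?thesis
      using norm_cube_combination_le[OF that(1), of s 0 y e] that(3) by simp
  qed
  then show thesis by (rule that)
qed

text \<open>The quotients c n / d n are coefficients in [0,1]. If d n = 0 then c n = 0 as well, and
  the convention for division by zero is harmless.\<close>

lemma unconditionally_Cauchy_mono:
  assumes y: "unconditionally_Cauchy (\<lambda>n. d n *\<^sub>R x n)" and c: "\<And>n. 0 \<le> c n" "\<And>n. c n \<le> d n"
  shows "unconditionally_Cauchy (\<lambda>n. c n *\<^sub>R x n)"
  unfolding unconditionally_Cauchy_def
proof (intro allI impI)
  fix e :: real assume "e > 0"
  then obtain N where N: "\<And>A s. finite A \<Longrightarrow> A \<subseteq> {N..} \<Longrightarrow> (\<And>n. s n \<in> {0..1::real}) \<Longrightarrow>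
    norm (\<Sum>n\<in>A. s n *\<^sub>R d n *\<^sub>R x n) \<le> e / 2"
    using unconditionally_Cauchy_cube[OF y, of "e / 2"] by auto
  have "(c n / d n) *\<^sub>R d n *\<^sub>R x n = c n *\<^sub>R x n" for n
    using c[of n] by (cases "d n = 0") auto
  moreover have "c n / d n \<in> {0..1}" for n
    using c[of n] by (auto simp: divide_le_eq_1)
  ultimately have "norm (\<Sum>n\<in>A. c n *\<^sub>R x n) < e" if "finite A" "A \<subseteq> {N..}" for A
    using N[OF that, of "\<lambda>n. c n / d n"] \<open>e > 0\<close> by (simp del: scaleR_scaleR)
  then show "\<exists>N. \<forall>A. finite A \<longrightarrow> A \<subseteq> {N..} \<longrightarrow> norm (\<Sum>n\<in>A. c n *\<^sub>R x n) < e"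
    by blast
qed

lemma unconditionally_Cauchy_finite_support:
  assumes "\<And>n. n \<ge> N \<Longrightarrow> y n = 0"
  shows "unconditionally_Cauchy y"
  unfolding unconditionally_Cauchy_def
proof (intro allI impI exI[of _ N])
  fix e :: real and A assume "e > 0" "A \<subseteq> {N..}"
  then have "sum y A = 0" using assms by (intro sum.neutral) auto
  with \<open>e > 0\<close> show "norm (sum y A) < e" by simp
qed

lemma summable_cube:
  fixes y :: "nat \<Rightarrow> 'a::banach"
  assumes y: "unconditionally_Cauchy y" and s: "\<And>n. s n \<in> {0..1::real}"
  shows "summable (\<lambda>n. s n *\<^sub>R y n)"
  unfolding summable_Cauchy
proof (intro allI impI)
  fix e :: real assume "e > 0"
  then obtain N where N: "\<And>A s. finite A \<Longrightarrow> A \<subseteq> {N..} \<Longrightarrow> (\<And>n. s n \<in> {0..1::real}) \<Longrightarrow>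
    norm (\<Sum>n\<in>A. s n *\<^sub>R y n) \<le> e / 2"
    using unconditionally_Cauchy_cube[OF y, of "e / 2"] by auto
  have "norm (\<Sum>n\<in>{m..<k}. s n *\<^sub>R y n) < e" if "m \<ge> N" for m k
  proof -
    have "{m..<k} \<subseteq> {N..}" using that by auto
    then show ?thesis using N[of "{m..<k}" s] s \<open>e > 0\<close> by fastforce
  qed
  then show "\<exists>N. \<forall>m\<ge>N. \<forall>k. norm (\<Sum>n\<in>{m..<k}. s n *\<^sub>R y n) < e" by blast
qed

lemma norm_cube_tail_le:
  fixes y :: "nat \<Rightarrow> 'a::banach"
  assumes y: "unconditionally_Cauchy y" and s: "\<And>n. s n \<in> {0..1::real}"
    and N: "\<And>A. finite A \<Longrightarrow> A \<subseteq> {N..} \<Longrightarrow> norm (\<Sum>n\<in>A. s n *\<^sub>R y n) \<le> e"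
  shows "norm ((\<Sum>n. s n *\<^sub>R y n) - (\<Sum>n<N. s n *\<^sub>R y n)) \<le> e"
proof (rule LIMSEQ_le_const2)
  show "(\<lambda>k. norm ((\<Sum>n<k. s n *\<^sub>R y n) - (\<Sum>n<N. s n *\<^sub>R y n)))
      \<longlonglongrightarrow> norm ((\<Sum>n. s n *\<^sub>R y n) - (\<Sum>n<N. s n *\<^sub>R y n))"
    by (intro tendsto_intros summable_LIMSEQ summable_cube y s)
  show "\<exists>K. \<forall>k\<ge>K. norm ((\<Sum>n<k. s n *\<^sub>R y n) - (\<Sum>n<N. s n *\<^sub>R y n)) \<le> e"
  proof (intro exI[of _ N] allI impI)
    fix k assume k: "k \<ge> N"
    then have "(\<Sum>n<k. s n *\<^sub>R y n) - (\<Sum>n<N. s n *\<^sub>R y n) = (\<Sum>n\<in>{..<k} - {..<N}. s n *\<^sub>R y n)"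
      by (intro sum_diff[symmetric]) auto
    also have "norm \<dots> \<le> e" by (intro N) auto
    finally show "norm ((\<Sum>n<k. s n *\<^sub>R y n) - (\<Sum>n<N. s n *\<^sub>R y n)) \<le> e" .
  qed
qed

text \<open>The zonoid generated by the segments from 0 to \<open>y n\<close>, as the image of the
  unit cube under summation. It has this meaning only when all these series converge, as they do for
  unconditionally Cauchy y in a Banach space.\<close>

definition cube_sums :: "(nat \<Rightarrow> 'a::real_normed_vector) \<Rightarrow> 'a set" where
  "cube_sums y = (\<lambda>s. \<Sum>n. s n *\<^sub>R y n) ` (UNIV \<rightarrow> {0..1})"

lemma cube_sumsE:
  assumes "v \<in> cube_sums y"
  obtains s where "\<forall>n. s n \<in> {0..1}" "v = (\<Sum>n. s n *\<^sub>R y n)"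
proof -
  obtain s where "s \<in> UNIV \<rightarrow> {0..1}" "v = (\<Sum>n. s n *\<^sub>R y n)"
    using assms unfolding cube_sums_def by (rule imageE)
  then show thesis using that[of s] by (simp add: Pi_iff)
qed

lemma cube_sumsI: "(\<And>n. s n \<in> {0..1}) \<Longrightarrow> (\<Sum>n. s n *\<^sub>R y n) \<in> cube_sums y"
  unfolding cube_sums_def by (rule imageI) simp

lemma cube_sums_nonempty: "cube_sums y \<noteq> {}"
  unfolding cube_sums_def by (auto simp: Pi_eq_empty)

text \<open>Tychonoff's theorem; the topology on functions is that of pointwise convergence.\<close>

lemma compact_unit_cube: "compact (UNIV \<rightarrow> {0..1} :: ('i \<Rightarrow> real) set)"
proof -
  have "compactin (product_topology (\<lambda>_::'i. euclidean) UNIV) (PiE UNIV (\<lambda>_. {0..1::real}))"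
    by (auto simp: compactin_PiE)
  then show ?thesis
    by (simp add: PiE_UNIV_domain euclidean_product_topology)
qed

text \<open>Each partial sum depends continuously on finitely many coordinates of s, and the tails
  are small uniformly over the cube, so summation is continuous on a compact space.\<close>

lemma compact_cube_sums:
  fixes y :: "nat \<Rightarrow> 'a::banach"
  assumes y: "unconditionally_Cauchy y"
  shows "compact (cube_sums y)"
  unfolding cube_sums_def
proof (rule compact_continuous_image[OF _ compact_unit_cube])
  have "uniform_limit (UNIV \<rightarrow> {0..1}) (\<lambda>N s. \<Sum>n<N. s n *\<^sub>R y n) (\<lambda>s. \<Sum>n. s n *\<^sub>R y n) sequentially"
  proof (rule uniform_limitI)
    fix e :: real assume "e > 0"
    then obtain N where N: "\<And>A s. finite A \<Longrightarrow> A \<subseteq> {N..} \<Longrightarrow> (\<And>n. s n \<in> {0..1::real}) \<Longrightarrow>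
      norm (\<Sum>n\<in>A. s n *\<^sub>R y n) \<le> e / 2"
      using unconditionally_Cauchy_cube[OF y, of "e / 2"] by auto
    have "dist (\<Sum>n<M. s n *\<^sub>R y n) (\<Sum>n. s n *\<^sub>R y n) < e"
      if "M \<ge> N" "s \<in> UNIV \<rightarrow> {0..1}" for M s
    proof -
      have s: "s n \<in> {0..1}" for n using that(2) by auto
      have "norm (\<Sum>n\<in>A. s n *\<^sub>R y n) \<le> e / 2" if "finite A" "A \<subseteq> {M..}" for A
        using N[OF that(1) _ s] that(2) \<open>M \<ge> N\<close> by force
      then have "norm ((\<Sum>n. s n *\<^sub>R y n) - (\<Sum>n<M. s n *\<^sub>R y n)) \<le> e / 2"
        by (rule norm_cube_tail_le[OF y s])
      then show ?thesis using \<open>e > 0\<close> by (simp add: dist_norm norm_minus_commute)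
    qed
    then show "\<forall>\<^sub>F M in sequentially. \<forall>s\<in>UNIV \<rightarrow> {0..1}.
        dist (\<Sum>n<M. s n *\<^sub>R y n) (\<Sum>n. s n *\<^sub>R y n) < e"
      unfolding eventually_sequentially by blast
  qed
  then show "continuous_on (UNIV \<rightarrow> {0..1}) (\<lambda>s. \<Sum>n. s n *\<^sub>R y n)"
  proof (rule uniform_limit_theorem[rotated])
    have "continuous_on (UNIV \<rightarrow> {0..1}) (\<lambda>s. \<Sum>n<M. s n *\<^sub>R y n)" for M
      by (intro continuous_intros continuous_on_subset[OF continuous_on_product_coordinates]) auto
    then show "\<forall>\<^sub>F M in sequentially. continuous_on (UNIV \<rightarrow> {0..1}) (\<lambda>s. \<Sum>n<M. s n *\<^sub>R y n)"
      by simp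
  qed simp
qed

lemma convex_cube_sums:
  fixes y :: "nat \<Rightarrow> 'a::banach"
  assumes y: "unconditionally_Cauchy y"
  shows "convex (cube_sums y)"
proof (rule convexI)
  fix v w :: 'a and a b :: real
  assume v: "v \<in> cube_sums y" and w: "w \<in> cube_sums y" and ab: "0 \<le> a" "0 \<le> b" "a + b = 1"
  obtain s where s: "\<forall>n. s n \<in> {0..1}" "v = (\<Sum>n. s n *\<^sub>R y n)"
    using v by (rule cube_sumsE)
  note s = s(1)[rule_format] s(2)
  obtain t where t: "\<forall>n. t n \<in> {0..1}" "w = (\<Sum>n. t n *\<^sub>R y n)"
    using w by (rule cube_sumsE)
  note t = t(1)[rule_format] t(2)
  have "a *\<^sub>R v + b *\<^sub>R w = (\<Sum>n. a *\<^sub>R s n *\<^sub>R y n + b *\<^sub>R t n *\<^sub>R y n)"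
    using suminf_add[OF summable_scaleR_right[OF summable_cube[OF y, of s]]
        summable_scaleR_right[OF summable_cube[OF y, of t]]]
      suminf_scaleR_right[OF summable_cube[OF y, of s]]
      suminf_scaleR_right[OF summable_cube[OF y, of t]] s t
    by simp
  also have "\<dots> = (\<Sum>n. (a * s n + b * t n) *\<^sub>R y n)"
    by (simp add: scaleR_add_left)
  also have "\<dots> \<in> cube_sums y"
  proof (rule cube_sumsI)
    show "a * s n + b * t n \<in> {0..1}" for n
      using convexD[OF convex_real_interval(5), of "s n" 0 1 "t n" a b] s(1) t(1) ab by simp
  qed
  finally show "a *\<^sub>R v + b *\<^sub>R w \<in> cube_sums y" .
qed

text \<open>Segments with nonnegative multiples of one direction add up to a single segment; here
  this happens in every coordinate at once.\<close>

lemma cube_sums_add: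
  fixes x :: "nat \<Rightarrow> 'a::banach"
  assumes cd: "\<And>n. 0 \<le> c n" "\<And>n. 0 \<le> d n"
    and x: "unconditionally_Cauchy (\<lambda>n. (c n + d n) *\<^sub>R x n)"
  shows "cube_sums (\<lambda>n. (c n + d n) *\<^sub>R x n) = cube_sums (\<lambda>n. c n *\<^sub>R x n) + cube_sums (\<lambda>n. d n *\<^sub>R x n)"
proof -
  have xc: "unconditionally_Cauchy (\<lambda>n. c n *\<^sub>R x n)" and xd: "unconditionally_Cauchy (\<lambda>n. d n *\<^sub>R x n)"
    using cd by (auto intro: unconditionally_Cauchy_mono[OF x])
  have split: "(\<Sum>n. s n *\<^sub>R c n *\<^sub>R x n) + (\<Sum>n. t n *\<^sub>R d n *\<^sub>R x n)
      = (\<Sum>n. (s n * c n + t n * d n) *\<^sub>R x n)"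
    if "\<And>n. s n \<in> {0..1}" "\<And>n. t n \<in> {0..1}" for s t
    using suminf_add[OF summable_cube[OF xc that(1)] summable_cube[OF xd that(2)]]
    by (simp add: scaleR_add_left)
  show ?thesis
  proof (intro equalityI subsetI)
    fix v assume "v \<in> cube_sums (\<lambda>n. (c n + d n) *\<^sub>R x n)"
    then obtain s where s: "\<forall>n. s n \<in> {0..1}" "v = (\<Sum>n. s n *\<^sub>R (c n + d n) *\<^sub>R x n)"
      by (rule cube_sumsE)
    note s = s(1)[rule_format] s(2)
    from s have "v = (\<Sum>n. s n *\<^sub>R c n *\<^sub>R x n) + (\<Sum>n. s n *\<^sub>R d n *\<^sub>R x n)"
      using split[of s s] by (simp add: distrib_left)
    also have "\<dots> \<in> cube_sums (\<lambda>n. c n *\<^sub>R x n) + cube_sums (\<lambda>n. d n *\<^sub>R x n)"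
      by (intro set_plus_intro cube_sumsI s(1))
    finally show "v \<in> cube_sums (\<lambda>n. c n *\<^sub>R x n) + cube_sums (\<lambda>n. d n *\<^sub>R x n)" .
  next
    fix v assume "v \<in> cube_sums (\<lambda>n. c n *\<^sub>R x n) + cube_sums (\<lambda>n. d n *\<^sub>R x n)"
    then obtain a b where ab: "v = a + b" "a \<in> cube_sums (\<lambda>n. c n *\<^sub>R x n)" "b \<in> cube_sums (\<lambda>n. d n *\<^sub>R x n)"
      by (rule set_plus_elim)
    obtain s where s: "\<forall>n. s n \<in> {0..1}" "a = (\<Sum>n. s n *\<^sub>R c n *\<^sub>R x n)"
      using ab(2) by (rule cube_sumsE)
    note s = s(1)[rule_format] s(2)
    obtain t where t: "\<forall>n. t n \<in> {0..1}" "b = (\<Sum>n. t n *\<^sub>R d n *\<^sub>R x n)"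
      using ab(3) by (rule cube_sumsE)
    note t = t(1)[rule_format] t(2)
    \<comment> \<open>The mean of s n and t n with weights c n and d n. If both weights vanish, r n
      is 0 by division by zero and both sides of \<open>r_eq\<close> are 0.\<close>
    define r where "r = (\<lambda>n. (s n * c n + t n * d n) / (c n + d n))"
    have r: "r n \<in> {0..1}" and r_eq: "r n * (c n + d n) = s n * c n + t n * d n" for n
    proof -
      have "s n * c n \<le> c n" "t n * d n \<le> d n" "0 \<le> s n * c n" "0 \<le> t n * d n"
        using s(1)[of n] t(1)[of n] cd[of n] by (auto intro: mult_left_le_one_le)
      then show "r n \<in> {0..1}" "r n * (c n + d n) = s n * c n + t n * d n"
        using cd[of n] unfolding r_def by (auto simp: divide_le_eq_1)
    qed
    have "v = (\<Sum>n. r n *\<^sub>R (c n + d n) *\<^sub>R x n)"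
      unfolding ab(1) s(2) t(2) split[OF s(1) t(1)] by (simp add: r_eq)
    also have "\<dots> \<in> cube_sums (\<lambda>n. (c n + d n) *\<^sub>R x n)"
      by (intro cube_sumsI r)
    finally show "v \<in> cube_sums (\<lambda>n. (c n + d n) *\<^sub>R x n)" .
  qed
qed

text \<open>Points with equal coefficients are compared. From N on the terms of w vanish, so there
  only the tail of y counts.\<close>

lemma hausdorff_dist_cube_sums_le:
  fixes y w :: "nat \<Rightarrow> 'a::banach"
  assumes y: "unconditionally_Cauchy y" and w: "unconditionally_Cauchy w"
    and w0: "\<And>n. n \<ge> N \<Longrightarrow> w n = 0"
    and tail: "\<And>A s. finite A \<Longrightarrow> A \<subseteq> {N..} \<Longrightarrow> (\<And>n. s n \<in> {0..1::real}) \<Longrightarrow>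
      norm (\<Sum>n\<in>A. s n *\<^sub>R y n) \<le> r"
  shows "hausdorff_dist (cube_sums y) (cube_sums w) \<le> (\<Sum>n<N. norm (y n - w n)) + r"
proof -
  have le: "dist (\<Sum>n. s n *\<^sub>R y n) (\<Sum>n. s n *\<^sub>R w n) \<le> (\<Sum>n<N. norm (y n - w n)) + r"
    if s: "\<And>n. s n \<in> {0..1}" for s
  proof -
    have "norm ((\<Sum>n. s n *\<^sub>R y n) - (\<Sum>n<N. s n *\<^sub>R y n)) \<le> r"
      using tail s by (intro norm_cube_tail_le y) auto
    moreover have "(\<Sum>n. s n *\<^sub>R w n) = (\<Sum>n<N. s n *\<^sub>R w n)"
      using w0 by (intro suminf_finite) auto
    moreover have "norm ((\<Sum>n<N. s n *\<^sub>R y n) - (\<Sum>n<N. s n *\<^sub>R w n)) \<le> (\<Sum>n<N. norm (y n - w n))"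
    proof -
      have "norm (s n *\<^sub>R (y n - w n)) \<le> norm (y n - w n)" for n
        using s[of n] by (simp add: mult_left_le_one_le)
      then show ?thesis
        unfolding sum_subtractf[symmetric] scaleR_diff_right[symmetric]
        by (intro order_trans[OF norm_sum] sum_mono)
    qed
    ultimately show ?thesis
      unfolding dist_norm
      using norm_triangle_ineq[of "(\<Sum>n. s n *\<^sub>R y n) - (\<Sum>n<N. s n *\<^sub>R y n)"
          "(\<Sum>n<N. s n *\<^sub>R y n) - (\<Sum>n<N. s n *\<^sub>R w n)"] by simp
  qed
  show ?thesis
  proof (rule hausdorff_dist_le)
    fix v assume "v \<in> cube_sums y"
    then obtain s where "\<forall>n. s n \<in> {0..1}" "v = (\<Sum>n. s n *\<^sub>R y n)"
      by (rule cube_sumsE)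
    then show "\<exists>b\<in>cube_sums w. dist v b \<le> (\<Sum>n<N. norm (y n - w n)) + r"
      using le[of s] cube_sumsI[of s w] by (intro bexI[of _ "\<Sum>n. s n *\<^sub>R w n"]) simp_all
  next
    fix v assume "v \<in> cube_sums w"
    then obtain s where "\<forall>n. s n \<in> {0..1}" "v = (\<Sum>n. s n *\<^sub>R w n)"
      by (rule cube_sumsE)
    then show "\<exists>a\<in>cube_sums y. dist a v \<le> (\<Sum>n<N. norm (y n - w n)) + r"
      using le[of s] cube_sumsI[of s y] by (intro bexI[of _ "\<Sum>n. s n *\<^sub>R y n"]) simp_all
  qed (rule cube_sums_nonempty)+
qed

section \<open>The variational Henstock integral\<close>

lemma convex_hull_zero_eq: "convex hull {0, b} = (\<lambda>u. u *\<^sub>R b) ` {0..1}"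
  unfolding segment_convex_hull[symmetric] closed_segment_image_interval by simp

text \<open>At most one set contains t, so the segment is a cube sum with at most one nonzero term.
  This gives the multifunction the same parametrization as its primitive.\<close>

lemma scaled_segment_eq_cube_sums:
  fixes x :: "nat \<Rightarrow> 'a::real_normed_vector"
  assumes disj: "\<And>m n. m \<noteq> n \<Longrightarrow> E m \<inter> E n = {}"
  shows "(\<lambda>v. c *\<^sub>R v) ` (convex hull {0, \<Sum>n. indicator (E n) t *\<^sub>R x n})
    = cube_sums (\<lambda>n. (c * indicator (E n) t) *\<^sub>R x n)" (is "?L = ?R")
proof -
  \<comment> \<open>If t lies in none of the sets, any k will do, and then b = 0.\<close>
  obtain k where k: "\<And>n. n \<noteq> k \<Longrightarrow> t \<notin> E n"
    using disj by (metis disjoint_iff)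
  define b where "b = (indicator (E k) t :: real) *\<^sub>R x k"
  have "(\<Sum>n. indicator (E n) t *\<^sub>R x n) = (\<Sum>n\<in>{k}. indicator (E n) t *\<^sub>R x n)"
    by (rule suminf_finite) (use k in auto)
  also have "\<dots> = b"
    by (subst sum.insert) (simp_all add: b_def)
  finally have g: "(\<Sum>n. indicator (E n) t *\<^sub>R x n) = b" .
  have sums: "(\<Sum>n. s n *\<^sub>R (c * indicator (E n) t) *\<^sub>R x n) = c *\<^sub>R s k *\<^sub>R b" for s
  proof -
    have "(\<Sum>n. s n *\<^sub>R (c * indicator (E n) t) *\<^sub>R x n)
        = (\<Sum>n\<in>{k}. s n *\<^sub>R (c * indicator (E n) t) *\<^sub>R x n)"
      by (rule suminf_finite) (use k in auto)
    also have "\<dots> = c *\<^sub>R s k *\<^sub>R b"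
      by (subst sum.insert) (simp_all add: b_def ac_simps)
    finally show ?thesis .
  qed
  show ?thesis
    unfolding g
  proof (intro equalityI subsetI)
    fix v assume "v \<in> (\<lambda>v. c *\<^sub>R v) ` (convex hull {0, b})"
    then obtain u where u: "u \<in> {0..1}" "v = c *\<^sub>R u *\<^sub>R b"
      unfolding convex_hull_zero_eq by blast
    have "(\<Sum>n. u *\<^sub>R (c * indicator (E n) t) *\<^sub>R x n) \<in> ?R"
      using u(1) by (rule cube_sumsI)
    then show "v \<in> ?R"
      unfolding sums u(2) .
  next
    fix v assume "v \<in> ?R"
    then obtain s where "\<forall>n. s n \<in> {0..1}" "v = (\<Sum>n. s n *\<^sub>R (c * indicator (E n) t) *\<^sub>R x n)"
      by (rule cube_sumsE)
    then have s: "s k \<in> {0..1}" "v = c *\<^sub>R s k *\<^sub>R b"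
      unfolding sums by blast+
    then show "v \<in> (\<lambda>v. c *\<^sub>R v) ` (convex hull {0, b})"
      unfolding convex_hull_zero_eq by blast
  qed
qed

section \<open>Intervals, gauges and tagged partitions\<close>

lemma measure_Int_nonoverlapping_Un:
  assumes E: "E \<in> lmeasurable" and I: "I \<in> subintervals" and J: "J \<in> subintervals"
    and "nonoverlapping I J"
  shows "measure lebesgue (E \<inter> (I \<union> J)) = measure lebesgue (E \<inter> I) + measure lebesgue (E \<inter> J)"
proof -
  have cx: "convex I" "convex J" and sets: "I \<in> sets lebesgue" "J \<in> sets lebesgue"
    using I J by (auto simp: subintervals_def)
  \<comment> \<open>The intersection is convex with empty interior.\<close>
  have "negligible (I \<inter> J)"
    using assms(4) cx by (simp add: negligible_convex_interior convex_Int nonoverlapping_def)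
  then have "negligible ((E \<inter> I) \<inter> (E \<inter> J))"
    by (rule negligible_subset) auto
  moreover have "E \<inter> I \<in> lmeasurable" "E \<inter> J \<in> lmeasurable"
    using E sets by (auto intro: fmeasurable_Int_fmeasurable)
  ultimately show ?thesis
    by (simp add: Int_Un_distrib measure_Un3 negligible_imp_measure0)
qed

text \<open>The Henstock lemma bounds a sum of absolute errors over partial divisions, which is
  precisely the variational form of integrability.\<close>

lemma Henstock_lemma_indicator:
  assumes E: "E \<in> lmeasurable" and e: "e > 0"
  obtains \<gamma> where "gauge \<gamma>"
    "\<And>p. p tagged_partial_division_of {0..1::real} \<Longrightarrow> \<gamma> fine p \<Longrightarrow>
      (\<Sum>(t, I)\<in>p. \<bar>measure lebesgue (E \<inter> I) - measure lborel I * indicator E t\<bar>) < e"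
proof -
  have Int: "E \<inter> cbox a b \<in> lmeasurable" for a b :: real
    using E by (intro fmeasurable_Int_fmeasurable) auto
  then have "(indicator E :: real \<Rightarrow> real) integrable_on cbox 0 1"
    by (simp add: integrable_on_indicator)
  then obtain \<gamma> where \<gamma>: "gauge \<gamma>"
    "\<And>p. p tagged_partial_division_of cbox 0 1 \<Longrightarrow> \<gamma> fine p \<Longrightarrow>
      (\<Sum>(t, I)\<in>p. norm (measure lborel I *\<^sub>R (indicator E t :: real) - integral I (indicator E))) < e"
    using Henstock_lemma[OF _ e] by blast
  show thesis
  proof (rule that[OF \<gamma>(1)])
    fix p assume p: "p tagged_partial_division_of {0..1::real}" "\<gamma> fine p"
    have "(\<Sum>(t, I)\<in>p. \<bar>measure lebesgue (E \<inter> I) - measure lborel I * indicator E t\<bar>)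
      = (\<Sum>(t, I)\<in>p. norm (measure lborel I *\<^sub>R (indicator E t :: real) - integral I (indicator E)))"
    proof (intro sum.cong refl, clarify)
      fix t I assume "(t, I) \<in> p"
      then obtain a b where "I = cbox a b"
        using p(1) tagged_partial_division_ofD(4) by blast
      then have "integral I (indicator E :: real \<Rightarrow> real) = measure lebesgue (E \<inter> I)"
        using Int by (simp add: integral_indicator)
      then show "\<bar>measure lebesgue (E \<inter> I) - measure lborel I * indicator E t\<bar>
          = norm (measure lborel I *\<^sub>R (indicator E t :: real) - integral I (indicator E))"
        by (simp add: abs_minus_commute)
    qed
    also have "\<dots> < e"
      using \<gamma>(2) p by simp
    finally show "(\<Sum>(t, I)\<in>p. \<bar>measure lebesgue (E \<inter> I) - measure lborel I * indicator E t\<bar>) < e" .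
  qed
qed

lemma gauge_openE:
  assumes "gauge \<gamma>"
  obtains r :: real where "r > 0" "{t - r<..<t + r} \<subseteq> \<gamma> t"
proof -
  have "open (\<gamma> t)" "t \<in> \<gamma> t" using assms by (auto simp: gauge_def)
  then obtain r where "r > 0" "ball t r \<subseteq> \<gamma> t" by (rule openE)
  then show thesis using that by (simp add: ball_eq_greaterThanLessThan)
qed

lemma sum_half_powers_le: "(\<Sum>n<M. (1 / 2) ^ Suc n) \<le> (1::real)"
proof -
  have "(\<Sum>n<M. (1 / 2) ^ Suc n) = 1 - (1 / 2 :: real) ^ M"
    by (induction M) auto
  then show ?thesis by simp
qed

lemma subintervals_if_tagged:
  assumes "p tagged_partial_division_of {0..1}" "(t, I) \<in> p"
  shows "I \<in> subintervals"
proof -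
  obtain a b where I: "I = {a..b}"
    using tagged_partial_division_ofD(4)[OF assms] by auto
  have "t \<in> I" "I \<subseteq> {0..1}"
    using tagged_partial_division_ofD(2,3)[OF assms] by auto
  then show ?thesis
    using I unfolding subintervals_def by fastforce
qed

text \<open>Two nondegenerate intervals with the tag \<open>0\<close> would overlap.\<close>

lemma card_tag_zero_le:
  assumes p: "p tagged_partial_division_of {0..1::real}"
  shows "card {q \<in> p. fst q = 0 \<and> snd q \<noteq> {0}} \<le> 1"
proof -
  have fin: "finite {q \<in> p. fst q = 0 \<and> snd q \<noteq> {0}}"
    using tagged_partial_division_ofD(1)[OF p] by simp
  have right: "\<exists>b>0. I = {0..b}" if I: "(0, I) \<in> p" "I \<noteq> {0}" for I
  proof -
    obtain a b where ab: "I = {a..b}" "0 \<le> a" "a \<le> b"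
      using subintervals_if_tagged[OF p I(1)] by (auto simp: subintervals_def)
    then have "a = 0" using tagged_partial_division_ofD(2)[OF p I(1)] by simp
    moreover have "b \<noteq> 0" using ab I(2) \<open>a = 0\<close> by auto
    ultimately show ?thesis using ab by auto
  qed
  have "I = J" if I: "(0, I) \<in> p" "I \<noteq> {0}" and J: "(0, J) \<in> p" "J \<noteq> {0}" for I J
  proof (rule ccontr)
    assume "I \<noteq> J"
    then have "interior I \<inter> interior J = {}"
      using tagged_partial_division_ofD(5)[OF p I(1) J(1)] by blast
    moreover obtain b b' where "b > 0" "I = {0..b}" "b' > 0" "J = {0..b'}"
      using right[OF I] right[OF J] by blast
    then have "min b b' / 2 \<in> interior I \<inter> interior J"
      by (auto simp: min_def)
    ultimately show False by blast
  qed
  then show ?thesis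
    using fin by (auto simp: card_le_Suc0_iff_eq)
qed

section \<open>The primitive and the variational estimate\<close>

lemma interval_multimeasure_cube_sums:
  fixes x :: "nat \<Rightarrow> 'a::banach"
  assumes E: "\<And>n. E n \<in> lmeasurable"
    and unc: "unconditionally_Cauchy (\<lambda>n. measure lebesgue (E n) *\<^sub>R x n)"
  shows "interval_multimeasure (\<lambda>I. cube_sums (\<lambda>n. measure lebesgue (E n \<inter> I) *\<^sub>R x n))"
  unfolding interval_multimeasure_def additive_interval_function_def
proof (intro conjI ballI impI)
  have unc': "unconditionally_Cauchy (\<lambda>n. measure lebesgue (E n \<inter> I) *\<^sub>R x n)"
    if "I \<in> subintervals" for I
  proof (rule unconditionally_Cauchy_mono[OF unc])
    have "I \<in> sets lebesgue" using that by (auto simp: subintervals_def)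
    then show "measure lebesgue (E n \<inter> I) \<le> measure lebesgue (E n)" for n
      using E[of n] by (intro measure_mono_fmeasurable) auto
  qed simp
  show "cube_sums (\<lambda>n. measure lebesgue (E n \<inter> I) *\<^sub>R x n) \<in> ck" if "I \<in> subintervals" for I
    using unc'[OF that] by (simp add: ck_def cube_sums_nonempty convex_cube_sums compact_cube_sums)
  fix I J assume IJ: "I \<in> subintervals" "J \<in> subintervals"
    and un: "nonoverlapping I J \<and> I \<union> J \<in> subintervals"
  have add: "measure lebesgue (E n \<inter> (I \<union> J)) = measure lebesgue (E n \<inter> I) + measure lebesgue (E n \<inter> J)" for n
    using measure_Int_nonoverlapping_Un[OF E IJ] un by blast
  show "cube_sums (\<lambda>n. measure lebesgue (E n \<inter> (I \<union> J)) *\<^sub>R x n)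
      = cube_sums (\<lambda>n. measure lebesgue (E n \<inter> I) *\<^sub>R x n)
        + cube_sums (\<lambda>n. measure lebesgue (E n \<inter> J) *\<^sub>R x n)"
    using unc'[of "I \<union> J"] un unfolding add by (intro cube_sums_add) auto
qed

text \<open>At a tag \<open>t > 0\<close> only finitely many \<open>E n\<close> matter, and the Henstock lemma for each
  indicator function, with error proportional to \<open>2\<^sup>-\<^sup>n\<close>, controls them. At the tag \<open>0\<close> the
  tail is small by unconditional convergence and the initial part because the interval is short.\<close>

theorem vH_integrable_multi_segments:
  fixes x :: "nat \<Rightarrow> 'a::banach"
  assumes E: "\<And>n. E n \<in> lmeasurable" and disj: "\<And>m n. m \<noteq> n \<Longrightarrow> E m \<inter> E n = {}"
    and zero: "\<And>n. 0 \<notin> E n"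
    and locfin: "\<And>t. t > 0 \<Longrightarrow> \<exists>N. \<exists>d>0. \<forall>n\<ge>N. E n \<inter> {t - d<..<t + d} = {}"
    and unc: "unconditionally_Cauchy (\<lambda>n. measure lebesgue (E n) *\<^sub>R x n)"
    and g: "\<And>t. t \<in> {0..1} \<Longrightarrow> g t = (\<Sum>n. indicator (E n) t *\<^sub>R x n)"
  shows "vH_integrable_multi (\<lambda>t. convex hull {0, g t})"
proof -
  define c where "c = (\<lambda>n I. measure lebesgue (E n \<inter> I))"
  define y where "y = (\<lambda>I n. c n I *\<^sub>R x n)"
  define w where "w = (\<lambda>t (I :: real set) n. (measure lborel I * indicator (E n) t :: real) *\<^sub>R x n)"
  define H where "H = (\<lambda>(t, I). hausdorff_dist (cube_sums (y I)) ((\<lambda>v. measure lborel I *\<^sub>R v) ` (convex hull {0, g t})))"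
  define F where "F = (\<lambda>n (t, I). norm (x n) * \<bar>c n I - measure lborel I * indicator (E n) t\<bar>)"
  have ck: "convex hull {0, g t} \<in> ck" for t
    unfolding ck_def by (simp add: segment_convex_hull[symmetric])
  have c_mono: "c n I \<le> measure lebesgue (E n)" and c_le: "c n I \<le> measure lborel I"
    and c_nonneg: "0 \<le> c n I" if sub: "I \<in> subintervals" for n I
  proof -
    obtain a b where I: "I = {a..b}" using sub by (auto simp: subintervals_def)
    then have "measure lebesgue (E n \<inter> I) \<le> measure lebesgue I"
      using E[of n] by (intro measure_mono_fmeasurable) auto
    then show "c n I \<le> measure lborel I" using I by (simp add: c_def)
    show "c n I \<le> measure lebesgue (E n)"
      unfolding c_def using E[of n] I by (intro measure_mono_fmeasurable) auto
  qed (simp add: c_def)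
  have y_unc: "unconditionally_Cauchy (y I)" if "I \<in> subintervals" for I
    unfolding y_def using c_mono[OF that] c_nonneg[OF that]
    by (intro unconditionally_Cauchy_mono[OF unc]) auto
  have F_eq: "norm (y I n - w t I n) = F n (t, I)" for n t I
    unfolding y_def w_def F_def scaleR_diff_left[symmetric] by simp
  \<comment> \<open>Applied with r = 0 when the terms \<open>y I n\<close> vanish from N on, and
    with r = \<eta> for a nondegenerate interval tagged by 0.\<close>
  have H_le: "H (t, I) \<le> (\<Sum>n<N. F n (t, I)) + r"
    if I: "I \<in> subintervals" and t: "t \<in> {0..1}" and w0: "\<And>n. n \<ge> N \<Longrightarrow> t \<notin> E n"
      and tail: "\<And>A s. finite A \<Longrightarrow> A \<subseteq> {N..} \<Longrightarrow> (\<And>n. s n \<in> {0..1::real}) \<Longrightarrow>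
        norm (\<Sum>n\<in>A. s n *\<^sub>R y I n) \<le> r" for t I N r
  proof -
    have w0': "w t I n = 0" if "n \<ge> N" for n
      using w0[OF that] by (simp add: w_def)
    have "H (t, I) = hausdorff_dist (cube_sums (y I)) (cube_sums (w t I))"
      unfolding H_def w_def prod.case g[OF t]
      by (subst scaled_segment_eq_cube_sums) (use disj in simp_all)
    also have "\<dots> \<le> (\<Sum>n<N. norm (y I n - w t I n)) + r"
      by (intro hausdorff_dist_cube_sums_le y_unc[OF I] unconditionally_Cauchy_finite_support[OF w0'] w0' tail)
    finally show ?thesis unfolding F_eq .
  qed
  obtain N d where Nd: "\<And>t. t > 0 \<Longrightarrow> d t > 0"
    "\<And>t n. t > 0 \<Longrightarrow> n \<ge> N t \<Longrightarrow> E n \<inter> {t - d t<..<t + d t} = {}"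
    using locfin by metis
  have "\<exists>\<delta>. (\<forall>t\<in>{0..1}. \<delta> t > 0) \<and> (\<forall>p. fine_perron_partition \<delta> p \<longrightarrow> sum H p < \<epsilon>)"
    if "\<epsilon> > 0" for \<epsilon>
  proof -
    \<comment> \<open>The tag 0 costs at most 2 \<eta>, all other tags together at most
      \<eta>.\<close>
    define \<eta> where "\<eta> = \<epsilon> / 4"
    have "\<eta> > 0" using that by (simp add: \<eta>_def)
    \<comment> \<open>The denominator compensates the factor norm (x n) in \<open>F\<close>; the 1
      avoids division by zero.\<close>
    define e where "e = (\<lambda>n. \<eta> * (1 / 2) ^ Suc n / (1 + norm (x n)))"
    have e_pos: "e n > 0" for n
      using \<open>\<eta> > 0\<close> by (simp add: e_def add_pos_nonneg)
    have "\<exists>\<gamma>. gauge \<gamma> \<and> (\<forall>p. p tagged_partial_division_of {0..1} \<longrightarrow> \<gamma> fine p \<longrightarrow>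
        (\<Sum>(t, I)\<in>p. \<bar>c n I - measure lborel I * indicator (E n) t\<bar>) < e n)" for n
    proof (rule Henstock_lemma_indicator[OF E[of n] e_pos[of n]])
      fix \<gamma> :: "real \<Rightarrow> real set"
      assume "gauge \<gamma>" "\<And>p. p tagged_partial_division_of {0..1} \<Longrightarrow> \<gamma> fine p \<Longrightarrow>
        (\<Sum>(t, I)\<in>p. \<bar>measure lebesgue (E n \<inter> I) - measure lborel I * indicator (E n) t\<bar>) < e n"
      then show ?thesis unfolding c_def by (intro exI[of _ \<gamma>] conjI allI impI)
    qed
    then have "\<exists>\<gamma>. \<forall>n. gauge (\<gamma> n) \<and> (\<forall>p. p tagged_partial_division_of {0..1} \<longrightarrow> \<gamma> n fine p \<longrightarrow>
        (\<Sum>(t, I)\<in>p. \<bar>c n I - measure lborel I * indicator (E n) t\<bar>) < e n)"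
      by (intro choice allI)
    then obtain \<gamma> where \<gamma>: "\<And>n. gauge (\<gamma> n)"
      "\<And>n p. p tagged_partial_division_of {0..1} \<Longrightarrow> \<gamma> n fine p \<Longrightarrow>
        (\<Sum>(t, I)\<in>p. \<bar>c n I - measure lborel I * indicator (E n) t\<bar>) < e n"
      by blast
    define \<rho> where "\<rho> = (\<lambda>n t. SOME r. r > 0 \<and> {t - r<..<t + r} \<subseteq> \<gamma> n t)"
    have \<rho>: "\<rho> n t > 0" "{t - \<rho> n t<..<t + \<rho> n t} \<subseteq> \<gamma> n t" for n t
    proof -
      obtain r where "r > 0 \<and> {t - r<..<t + r} \<subseteq> \<gamma> n t"
        using gauge_openE[OF \<gamma>(1)[of n], of t] by blast
      then have "\<rho> n t > 0 \<and> {t - \<rho> n t<..<t + \<rho> n t} \<subseteq> \<gamma> n t"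
        unfolding \<rho>_def by (rule someI)
      then show "\<rho> n t > 0" "{t - \<rho> n t<..<t + \<rho> n t} \<subseteq> \<gamma> n t" by auto
    qed
    obtain N0 where N0: "\<And>A s. finite A \<Longrightarrow> A \<subseteq> {N0..} \<Longrightarrow> (\<And>n. s n \<in> {0..1::real}) \<Longrightarrow>
      norm (\<Sum>n\<in>A. s n *\<^sub>R measure lebesgue (E n) *\<^sub>R x n) \<le> \<eta>"
      using unconditionally_Cauchy_cube[OF unc \<open>\<eta> > 0\<close>] by metis
    \<comment> \<open>An interval tagged by 0 will be shorter than \<eta> / R, so its first N0
      errors sum to at most \<eta>.\<close>
    define R where "R = 1 + (\<Sum>n<N0. norm (x n))"
    have "R > 0" unfolding R_def by (simp add: add_pos_nonneg sum_nonneg)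
    \<comment> \<open>For t > 0 only the gauges with n < N t have to be respected, so the minimum is
      over a finite set and positive; \<open>d t\<close> keeps the interval away from the other
      sets. At 0 no such N exists in general, hence the separate value.\<close>
    define \<delta> where "\<delta> = (\<lambda>t. if t = 0 then \<eta> / R
      else Min (insert (d t) ((\<lambda>n. \<rho> n t) ` {..<N t})))"
    have \<delta>_pos: "\<delta> t > 0" if "t \<in> {0..1}" for t
      using that \<open>\<eta> > 0\<close> \<open>R > 0\<close> Nd(1)[of t] \<rho>(1) by (auto simp: \<delta>_def)
    have \<delta>_le: "\<delta> t \<le> d t" "n < N t \<Longrightarrow> \<delta> t \<le> \<rho> n t" if "t > 0" for t n
      using that by (auto simp: \<delta>_def)
    have "sum H p < \<epsilon>" if fine: "fine_perron_partition \<delta> p" for p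
    proof -
      have p: "p tagged_partial_division_of {0..1}"
        and p_fine: "\<And>t I. (t, I) \<in> p \<Longrightarrow> I \<subseteq> {t - \<delta> t<..<t + \<delta> t}"
        using fine by (auto simp: fine_perron_partition_def fine_def)
      note pD = tagged_partial_division_ofD[OF p]
      have fin: "finite p" by (rule pD(1))
      have sub: "I \<in> subintervals" if "(t, I) \<in> p" for t I
        using subintervals_if_tagged[OF p that] .
      have tag: "t \<in> {0..1}" if "(t, I) \<in> p" for t I
        using pD(2,3)[OF that] by blast
      have H_zero: "H (0, I) \<le> (if I = {0} then 0 else 2 * \<eta>)" if q: "(0, I) \<in> p" for I
      proof (cases "I = {0}")
        case True
        \<comment> \<open>The degenerate interval must contribute nothing, as
          \<open>card_tag_zero_le\<close> does not count it.\<close>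
        have "c n {0} = 0" for n
          using zero[of n] by (simp add: c_def)
        then have "y I n = 0" for n
          using True by (simp add: y_def)
        then have "H (0, I) \<le> (\<Sum>n<0. F n (0, I)) + 0"
          using zero by (intro H_le sub[OF q]) auto
        then show ?thesis using True by simp
      next
        case False
        have "F n (0, I) \<le> norm (x n) * (\<eta> / R)" for n
        proof -
          obtain a b where ab: "I = {a..b}" "0 \<le> a" "a \<le> b"
            using sub[OF q] by (auto simp: subintervals_def)
          then have "b < \<eta> / R"
            using p_fine[OF q] by (auto simp: \<delta>_def)
          then have "measure lborel I \<le> \<eta> / R"
            using ab by simp
          then have "c n I \<le> \<eta> / R"
            using c_le[OF sub[OF q], of n] by linarith
          then show ?thesis
            using c_nonneg[OF sub[OF q], of n] zero[of n]
            by (simp add: F_def mult_left_mono del: times_divide_eq_right)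
        qed
        then have "(\<Sum>n<N0. F n (0, I)) \<le> (\<Sum>n<N0. norm (x n)) * (\<eta> / R)"
          unfolding sum_distrib_right by (intro sum_mono)
        also have "\<dots> \<le> R * (\<eta> / R)"
          using \<open>\<eta> > 0\<close> \<open>R > 0\<close> by (intro mult_right_mono) (auto simp: R_def)
        finally have "(\<Sum>n<N0. F n (0, I)) \<le> \<eta>"
          using \<open>R > 0\<close> by simp
        moreover have "H (0, I) \<le> (\<Sum>n<N0. F n (0, I)) + \<eta>"
        proof (rule H_le[OF sub[OF q]])
          fix A and s :: "nat \<Rightarrow> real" assume A: "finite A" "A \<subseteq> {N0..}" and s: "\<And>n. s n \<in> {0..1}"
          \<comment> \<open>Shrinking \<open>E n\<close> to \<open>E n \<inter> I\<close> only
            scales the coefficient by a number in [0,1], so N0 serves every interval I.\<close>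
          define s' where "s' = (\<lambda>n. s n * (c n I / measure lebesgue (E n)))"
          have "s n *\<^sub>R y I n = s' n *\<^sub>R measure lebesgue (E n) *\<^sub>R x n" for n
            using c_mono[OF sub[OF q], of n] c_nonneg[OF sub[OF q], of n]
            by (cases "measure lebesgue (E n) = 0") (auto simp: s'_def y_def)
          moreover have "s' n \<in> {0..1}" for n
          proof -
            have "0 \<le> c n I / measure lebesgue (E n)" "c n I / measure lebesgue (E n) \<le> 1"
              using c_mono[OF sub[OF q], of n] c_nonneg[OF sub[OF q], of n] by (auto simp: divide_le_eq_1)
            then show ?thesis
              using s[of n] unfolding s'_def by (auto intro: mult_le_one simp del: times_divide_eq_right)
          qed
          ultimately show "norm (\<Sum>n\<in>A. s n *\<^sub>R y I n) \<le> \<eta>"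
            using N0[OF A, of s'] by (simp del: scaleR_scaleR)
        qed (use zero in auto)
        ultimately show ?thesis using False by simp
      qed
      have H_pos: "H (t, I) \<le> (\<Sum>n<N t. F n (t, I))" if q: "(t, I) \<in> p" "t \<noteq> 0" for t I
      proof -
        have "t > 0" using tag[OF q(1)] q(2) by simp
        have disjoint: "E n \<inter> I = {}" if "n \<ge> N t" for n
          using Nd(2)[OF \<open>t > 0\<close> that] p_fine[OF q(1)] \<delta>_le(1)[OF \<open>t > 0\<close>] by fastforce
        have "H (t, I) \<le> (\<Sum>n<N t. F n (t, I)) + 0"
        proof (rule H_le[OF sub[OF q(1)] tag[OF q(1)]])
          show "t \<notin> E n" if "n \<ge> N t" for n
            using disjoint[OF that] pD(2)[OF q(1)] by blast
          fix A and s :: "nat \<Rightarrow> real" assume A: "A \<subseteq> {N t..}"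
          have "y I n = 0" if "n \<in> A" for n
            using disjoint[of n] A that by (auto simp: y_def c_def)
          then show "norm (\<Sum>n\<in>A. s n *\<^sub>R y I n) \<le> 0" by simp
        qed
        then show ?thesis by simp
      qed
      have "sum H {q\<in>p. fst q = 0} \<le> 2 * \<eta>"
      proof -
        have "sum H {q\<in>p. fst q = 0} \<le> (\<Sum>q\<in>{q\<in>p. fst q = 0}. if snd q = {0} then 0 else 2 * \<eta>)"
        proof (rule sum_mono)
          fix q assume "q \<in> {q\<in>p. fst q = 0}"
          then obtain I where "q = (0, I)" "(0, I) \<in> p" by (cases q) auto
          then show "H q \<le> (if snd q = {0} then 0 else 2 * \<eta>)"
            using H_zero by (simp only: snd_conv)
        qed
        also have "\<dots> = (\<Sum>q\<in>{q \<in> p. fst q = 0 \<and> snd q \<noteq> {0}}. 2 * \<eta>)"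
          using fin by (intro sum.mono_neutral_cong_right) auto
        also have "\<dots> = card {q \<in> p. fst q = 0 \<and> snd q \<noteq> {0}} * (2 * \<eta>)"
          by simp
        also have "\<dots> \<le> 1 * (2 * \<eta>)"
          using card_tag_zero_le[OF p] \<open>\<eta> > 0\<close> by (intro mult_right_mono) auto
        finally show ?thesis by simp
      qed
      moreover have "sum H {q\<in>p. fst q \<noteq> 0} \<le> \<eta>"
      proof -
        \<comment> \<open>A common bound for N over the finitely many tags allows the sums over n
          and over p to be interchanged.\<close>
        obtain M where M: "\<And>q. q \<in> p \<Longrightarrow> N (fst q) \<le> M"
          using finite_nat_set_iff_bounded_le[of "(\<lambda>q. N (fst q)) ` p"] fin by auto
        have "sum H {q\<in>p. fst q \<noteq> 0} \<le> (\<Sum>q\<in>{q\<in>p. fst q \<noteq> 0}. \<Sum>n<N (fst q). F n q)"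
          using H_pos by (intro sum_mono) auto
        also have "\<dots> = (\<Sum>q\<in>{q\<in>p. fst q \<noteq> 0}. \<Sum>n | n \<in> {..<M} \<and> n < N (fst q). F n q)"
          using M by (intro sum.cong refl) (auto intro: less_le_trans)
        also have "\<dots> = (\<Sum>n<M. \<Sum>q | q \<in> {q\<in>p. fst q \<noteq> 0} \<and> n < N (fst q). F n q)"
          using fin by (intro sum.swap_restrict) auto
        also have "\<dots> \<le> (\<Sum>n<M. \<eta> * (1 / 2) ^ Suc n)"
        proof (intro sum_mono)
          fix n
          \<comment> \<open>The pairs to whose estimate \<open>E n\<close> contributes. They form a
            partial division that is fine for \<gamma> n, although p as a whole need not be.\<close>
          define P where "P = {q. q \<in> {q\<in>p. fst q \<noteq> 0} \<and> n < N (fst q)}"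
          have "P tagged_partial_division_of {0..1}"
            using p by (rule tagged_partial_division_subset) (auto simp: P_def)
          moreover have "\<gamma> n fine P"
          proof (rule fineI)
            fix t I assume "(t, I) \<in> P"
            then have q: "(t, I) \<in> p" "t \<noteq> 0" "n < N t" by (auto simp: P_def)
            have "t > 0" using tag[OF q(1)] q(2) by simp
            then have "\<delta> t \<le> \<rho> n t" using \<delta>_le(2) q(3) by blast
            then show "I \<subseteq> \<gamma> n t"
              using p_fine[OF q(1)] \<rho>(2)[where n = n and t = t] by fastforce
          qed
          ultimately have less: "(\<Sum>(t, I)\<in>P. \<bar>c n I - measure lborel I * indicator (E n) t\<bar>) < e n"
            by (rule \<gamma>(2))
          have "sum (F n) P = norm (x n) * (\<Sum>(t, I)\<in>P. \<bar>c n I - measure lborel I * indicator (E n) t\<bar>)"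
            unfolding F_def sum_distrib_left by (intro sum.cong) auto
          also have "\<dots> \<le> norm (x n) * e n"
            using less by (intro mult_left_mono) auto
          also have "\<dots> \<le> (1 + norm (x n)) * e n"
            using e_pos[of n] by (intro mult_right_mono) auto
          also have "\<dots> = \<eta> * (1 / 2) ^ Suc n"
            unfolding e_def times_divide_eq_right
            by (rule nonzero_mult_div_cancel_left) (use norm_ge_zero[of "x n"] in linarith)
          finally show "sum (F n) {q. q \<in> {q\<in>p. fst q \<noteq> 0} \<and> n < N (fst q)} \<le> \<eta> * (1 / 2) ^ Suc n"
            unfolding P_def .
        qed
        also have "\<dots> \<le> \<eta> * 1"
          unfolding sum_distrib_left[symmetric]
          using \<open>\<eta> > 0\<close> sum_half_powers_le by (intro mult_left_mono) auto
        finally show ?thesis by simp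
      qed
      moreover have "sum H p = sum H {q\<in>p. fst q = 0} + sum H {q\<in>p. fst q \<noteq> 0}"
        using fin by (subst sum.union_disjoint[symmetric]) (auto intro: sum.cong)
      ultimately show ?thesis
        using \<open>\<eta> > 0\<close> by (simp add: \<eta>_def)
    qed
    with \<delta>_pos show ?thesis by blast
  qed
  then show ?thesis
    unfolding vH_integrable_multi_def
    using ck interval_multimeasure_cube_sums[OF E unc]
    by (intro conjI ballI exI[of _ "\<lambda>I. cube_sums (y I)"]) (auto simp: H_def y_def c_def)
qed

section \<open>From Pettis integrability to unconditional convergence\<close>

lemma pettis_integrable_unconditionally_Cauchy:
  fixes x :: "nat \<Rightarrow> 'a::real_normed_vector"
  assumes pettis: "pettis_integrable g"
    and E: "\<And>n. E n \<in> sets lebesgue" "\<And>n. E n \<subseteq> {0..1}" "\<And>m n. m \<noteq> n \<Longrightarrow> E m \<inter> E n = {}"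
    and g: "\<And>n t. t \<in> E n \<Longrightarrow> g t = x n"
  shows "unconditionally_Cauchy (\<lambda>n. measure lebesgue (E n) *\<^sub>R x n)"
proof -
  define y where "y = (\<lambda>n. measure lebesgue (E n) *\<^sub>R x n)"
  have Em: "E n \<in> lmeasurable" for n
    using E(1,2)[of n] bounded_subset[OF bounded_closed_interval] by (intro bounded_set_imp_lmeasurable) auto
  have int: "set_integrable lebesgue {0..1} (\<lambda>t. f (g t))" if "bounded_linear f" for f :: "'a \<Rightarrow> real"
    using pettis that unfolding pettis_integrable_def by blast
  have set_int: "(LINT t:E n|lebesgue. h (g t)) = measure lebesgue (E n) * h (x n)" for n and h :: "'a \<Rightarrow> real"
  proof -
    have "(LINT t:E n|lebesgue. h (g t)) = (LINT t:E n|lebesgue. h (x n))"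
      using E(1) g by (intro set_lebesgue_integral_cong) auto
    also have "\<dots> = measure lebesgue (E n) * h (x n)"
      using Em[of n] by (subst set_integral_const) (auto simp: fmeasurable_def)
    finally show ?thesis .
  qed
  have f_y: "f (y n) = measure lebesgue (E n) * f (x n)" if "bounded_linear f" for f :: "'a \<Rightarrow> real" and n
    using linear_cmul[OF bounded_linear.linear[OF that]] by (simp add: y_def)
  \<comment> \<open>The partial sums are integrals of |f(g(t))| over disjoint unions of the sets, so
    the integral over [0,1] bounds them all.\<close>
  have abs: "summable (\<lambda>n. \<bar>f (y n)\<bar>)" if f: "bounded_linear f" for f :: "'a \<Rightarrow> real"
  proof (rule summableI_nonneg_bounded)
    fix k
    have int': "set_integrable lebesgue A (\<lambda>t. \<bar>f (g t)\<bar>)"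
      if "A \<in> sets lebesgue" "A \<subseteq> {0..1}" for A
      using set_integrable_subset[OF set_integrable_abs[OF int[OF f]] that] .
    have "(\<Sum>n<k. \<bar>f (y n)\<bar>) = (\<Sum>n<k. LINT t:E n|lebesgue. \<bar>f (g t)\<bar>)"
      using set_int[of _ "\<lambda>v. \<bar>f v\<bar>"] by (simp add: f_y[OF f] abs_mult)
    also have "\<dots> = (LINT t:(\<Union>n<k. E n)|lebesgue. \<bar>f (g t)\<bar>)"
      using E int' by (intro set_integral_finite_Union[symmetric]) (auto simp: disjoint_family_on_def)
    also have "\<dots> \<le> (LINT t:{0..1}|lebesgue. \<bar>f (g t)\<bar>)"
      unfolding set_lebesgue_integral_def
    proof (rule integral_mono)
      show "integrable lebesgue (\<lambda>t. indicat_real (\<Union>n<k. E n) t *\<^sub>R \<bar>f (g t)\<bar>)"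
        using int'[of "\<Union>n<k. E n"] E(1,2) by (auto simp: set_integrable_def)
      show "integrable lebesgue (\<lambda>t. indicat_real {0..1} t *\<^sub>R \<bar>f (g t)\<bar>)"
        using int'[of "{0..1}"] by (simp add: set_integrable_def)
      show "indicat_real (\<Union>n<k. E n) t *\<^sub>R \<bar>f (g t)\<bar> \<le> indicat_real {0..1} t *\<^sub>R \<bar>f (g t)\<bar>" for t
        using subsetD[OF E(2)] by (auto simp: indicator_def)
    qed
    finally show "(\<Sum>n<k. \<bar>f (y n)\<bar>) \<le> (LINT t:{0..1}|lebesgue. \<bar>f (g t)\<bar>)" .
  qed simp
  have sub: "\<exists>z. \<forall>f :: 'a \<Rightarrow> real. bounded_linear f \<longrightarrow> f z = (\<Sum>n. indicator S n * f (y n))" for S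
  proof -
    \<comment> \<open>Subseries correspond to unions of the sets: the Pettis integral of g over the
      union of the \<open>E n\<close> with n in S is the weak sum over S.\<close>
    define A where "A = (\<lambda>n. if n \<in> S then E n else {})"
    have A: "\<And>n. A n \<in> sets lebesgue" "(\<Union>n. A n) \<subseteq> {0..1}" "\<And>m n. m \<noteq> n \<Longrightarrow> A m \<inter> A n = {}"
      using E by (auto simp: A_def)
    then have UN: "(\<Union>n. A n) \<in> sets lebesgue"
      by (intro sets.countable_UN) auto
    obtain z where "\<forall>f :: 'a \<Rightarrow> real. bounded_linear f \<longrightarrow>
        f z = (LINT t:(\<Union>n. A n)|lebesgue. f (g t))"
      using pettis[unfolded pettis_integrable_def, THEN conjunct2, rule_format, OF UN A(2)] by (rule exE)
    note z = this[rule_format]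
    have "f z = (\<Sum>n. indicator S n * f (y n))" if f: "bounded_linear f" for f :: "'a \<Rightarrow> real"
    proof -
      have "set_integrable lebesgue (\<Union>n. A n) (\<lambda>t. f (g t))"
        using UN A(2) by (rule set_integrable_subset[OF int[OF f]])
      then have "f z = (\<Sum>n. LINT t:A n|lebesgue. f (g t))"
        unfolding z[OF f] by (intro lebesgue_integral_countable_add A)
      moreover have "(LINT t:A n|lebesgue. f (g t)) = indicator S n * f (y n)" for n
        using set_int[of n f] by (simp add: A_def f_y[OF f] set_lebesgue_integral_def)
      ultimately show ?thesis by simp
    qed
    then show ?thesis by blast
  qed
  show ?thesis
    unfolding y_def[symmetric] unconditionally_Cauchy_def
    using Orlicz_Pettis[OF abs sub] by metis
qed

theorem proposition2p9:
  fixes a :: "nat \<Rightarrow> real"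
    and E :: "nat \<Rightarrow> real set"
    and x :: "nat \<Rightarrow> 'a::banach"
    and g :: "real \<Rightarrow> 'a"
  assumes "\<And>m n. 1 \<le> m \<Longrightarrow> m \<le> n \<Longrightarrow> a n \<le> a m"
    and "a 1 = 1"
    and "a \<longlonglongrightarrow> 0"
    and "\<And>n. n \<ge> 1 \<Longrightarrow> E n \<subseteq> {a (n + 1) <..< a n}"
    and "\<And>t. t \<in> {0..1} \<Longrightarrow> g t = (\<Sum>n. indicator (E (Suc n)) t *\<^sub>R x (Suc n))"
    and "pettis_integrable g"
    and "vH_integrable g"
  shows "vH_integrable_multi (\<lambda>t. convex hull {0, g t})"
proof -
  define b where "b = (\<lambda>n. a (Suc n))"
  define z where "z = (\<lambda>n. x (Suc n))"
  \<comment> \<open>Where the coefficient is zero, \<open>E (Suc n)\<close> may be nonmeasurable;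
    replacing it by the empty set leaves g unchanged.\<close>
  define D where "D = (\<lambda>n. if z n = 0 then {} else E (Suc n))"
  have b_mono: "b n \<le> b m" if "m \<le> n" for m n
    using assms(1)[of "Suc m" "Suc n"] that by (simp add: b_def)
  have b_lim: "b \<longlonglongrightarrow> 0"
    unfolding b_def using assms(3) by (rule LIMSEQ_Suc)
  have b_le: "b n \<le> 1" for n
    using b_mono[of 0 n] assms(2) by (simp add: b_def)
  have b_ge: "0 \<le> b n" for n
    using b_mono by (intro decseq_ge[OF _ b_lim]) (auto simp: decseq_def)
  have E_sub: "E (Suc n) \<subseteq> {b (Suc n)<..<b n}" for n
    using assms(4)[of "Suc n"] by (simp add: b_def)
  then have D_sub: "D n \<subseteq> {b (Suc n)<..<b n}" for n
    by (auto simp: D_def)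
  then have D_01: "D n \<subseteq> {0<..<1}" for n
    using b_le[of n] b_ge[of "Suc n"] by fastforce
  then have D_Icc: "D n \<subseteq> {0..1}" for n
    by fastforce
  have E_disj: "E (Suc m) \<inter> E (Suc n) = {}" if "m \<noteq> n" for m n
  proof -
    have "E (Suc i) \<inter> E (Suc j) = {}" if "i < j" for i j
      using E_sub[of i] E_sub[of j] b_mono[of "Suc i" j] that by fastforce
    then show ?thesis using \<open>m \<noteq> n\<close> by (metis Int_commute linorder_neqE_nat)
  qed
  then have D_disj: "D m \<inter> D n = {}" if "m \<noteq> n" for m n
    using that by (auto simp: D_def)
  have g: "g t = (\<Sum>n. indicator (D n) t *\<^sub>R z n)" if "t \<in> {0..1}" for t
  proof -
    have "indicator (E (Suc n)) t *\<^sub>R x (Suc n) = indicator (D n) t *\<^sub>R z n" for n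
      by (simp add: D_def z_def)
    then show ?thesis using assms(5)[OF that] by simp
  qed
  have g_E: "g t = z n" if "t \<in> E (Suc n)" for t n
  proof -
    have t: "t \<in> {0..1}"
      using that E_sub[of n] b_le[of n] b_ge[of "Suc n"] by fastforce
    have other: "t \<notin> E (Suc m)" if "m \<noteq> n" for m
      using E_disj[OF that] \<open>t \<in> E (Suc n)\<close> by blast
    have "g t = (\<Sum>m\<in>{n}. indicator (E (Suc m)) t *\<^sub>R x (Suc m))"
      unfolding assms(5)[OF t] by (rule suminf_finite) (use other in auto)
    then show ?thesis using that by (simp add: z_def)
  qed
  have D_meas: "D n \<in> sets lebesgue" for n
  proof (cases "z n = 0")
    case True
    then show ?thesis by (simp add: D_def)
  next
    case False
    \<comment> \<open>Since f(z n) is nonzero, \<open>D n\<close> is the part of the measurable set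
      where f(g(t)) is nonzero that lies between \<open>b (Suc n)\<close> and
      \<open>b n\<close>.\<close>
    obtain f :: "'a \<Rightarrow> real" where f: "bounded_linear f" "f (z n) = norm (z n)"
      using norming_functional by metis
    have f0: "f 0 = 0" using linear_0[OF bounded_linear.linear[OF f(1)]] .
    have "set_integrable lebesgue {0..1} (\<lambda>t. f (g t))"
      using assms(6) f(1) unfolding pettis_integrable_def by blast
    then have "set_borel_measurable lebesgue {0..1} (\<lambda>t. f (g t))"
      unfolding set_integrable_def set_borel_measurable_def by (rule borel_measurable_integrable)
    then have "(\<lambda>t. f (g t)) -` (- {0}) \<inter> {0..1} \<in> sets lebesgue"
      by (rule set_borel_measurable_sets) auto
    then have "(\<lambda>t. f (g t)) -` (- {0}) \<inter> {0..1} \<inter> {b (Suc n)<..<b n} \<in> sets lebesgue"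
      by (rule sets.Int) auto
    also have "(\<lambda>t. f (g t)) -` (- {0}) \<inter> {0..1} \<inter> {b (Suc n)<..<b n} = D n"
    proof (intro equalityI subsetI)
      fix t assume t: "t \<in> D n"
      then have "t \<in> E (Suc n)" using False by (simp add: D_def)
      then have "f (g t) \<noteq> 0" using g_E f(2) False by simp
      then show "t \<in> (\<lambda>t. f (g t)) -` (- {0}) \<inter> {0..1} \<inter> {b (Suc n)<..<b n}"
        using t D_sub[of n] D_01[of n] by fastforce
    next
      fix t assume t: "t \<in> (\<lambda>t. f (g t)) -` (- {0}) \<inter> {0..1} \<inter> {b (Suc n)<..<b n}"
      have "\<exists>m. t \<in> D m"
      proof (rule ccontr)
        assume "\<not> ?thesis"
        then have "g t = 0" using g[of t] t by simp
        then show False using t f0 by simp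
      qed
      then obtain m where m: "t \<in> D m" ..
      have "m = n"
        using D_sub[of m] m t b_mono[of "Suc m" n] b_mono[of "Suc n" m]
        by (cases m n rule: linorder_cases) fastforce+
      with m show "t \<in> D n" by simp
    qed
    finally show ?thesis .
  qed
  show ?thesis
  proof (rule vH_integrable_multi_segments[OF _ D_disj _ _ _ g])
    show "D n \<in> lmeasurable" for n
      using D_meas bounded_subset[OF bounded_closed_interval D_Icc]
      by (intro bounded_set_imp_lmeasurable)
    show "0 \<notin> D n" for n
      using D_01[of n] by auto
    show "\<exists>N. \<exists>d>0. \<forall>n\<ge>N. D n \<inter> {t - d<..<t + d} = {}" if "t > 0" for t
    proof -
      \<comment> \<open>From N on, the sets \<open>D n\<close> lie below t/2, so the radius d = t/2
        separates them from t.\<close>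
      obtain N where "\<And>n. n \<ge> N \<Longrightarrow> b n < t / 2"
        using order_tendstoD(2)[OF b_lim, of "t / 2"] \<open>t > 0\<close> unfolding eventually_sequentially by auto
      then have "D n \<inter> {t - t / 2<..<t + t / 2} = {}" if "n \<ge> N" for n
        using D_sub[of n] that by fastforce
      then show ?thesis using \<open>t > 0\<close> half_gt_zero by blast
    qed
    show "unconditionally_Cauchy (\<lambda>n. measure lebesgue (D n) *\<^sub>R z n)"
    proof (rule pettis_integrable_unconditionally_Cauchy[OF assms(6) D_meas _ D_disj])
      show "D n \<subseteq> {0..1}" for n by (rule D_Icc)
      show "g t = z n" if "t \<in> D n" for n t
        using g_E that by (auto simp: D_def split: if_splits)
    qed
  qed
qed

end
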